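(* Let $0<q<1$ and let $(a,c,d)$ be an admissible triple: $a>0$ and $(c,d)$ satisfies one of: $d=\bar c\in\mathbb C\setminus\mathbb R$; or $aq^m<c,d<aq^{m-1}$ for some $m\in\mathbb Z$; or $c,d<0$ and $q<cd^{-1}<q^{-1}$. Let $\varphi^{qM}_{\lambda|N}$ be the $N$-variate $q$-Meixner polynomials and $\Phi^{qM}_\lambda$ the $q$-Meixner symmetric functions. Then for every partition $\lambda$, as $N\to\infty$, $$\varphi^{qM}_{\lambda|N}(\,\cdot\,;q;a,cq^{1-N},dq^{1-N})\longrightarrow\Phi^{qM}_\lambda(\,\cdot\,;q;a,c,d)$$ in the sense of convergence of elements of $\mathrm{Sym}(N)$ to an element of $\mathrm{Sym}$ defined in the context.
   Context: Notation: $(x;q)_n=\prod_{k=0}^{n-1}(1-xq^k)$ for $n\ge0$. $\ell(\lambda)$ is the number of nonzero parts, $|\lambda|=\sum\lambda_i$, $n(\lambda)=\sum_i(i-1)\lambda_i$, $\lambda'$ is the transposed partition (so $n(\lambda')=\sum_i\binom{\lambda_i}2$), $\mathbb Y(N)$ is the set of partitions with at most $N$ nonzero parts. $\mathrm{Sym}$ is the algebra of symmetric functions over $\mathbb C$, $\mathrm{Sym}(N)$ the symmetric polynomials in $N$ variables, the subscript $\le d$ means degree at most $d$. $V(x_1,\dots,x_N)=\prod_{i<j}(x_i-x_j)$. For variables $X=(x_1,x_2,\dots)$, $F(Xc)=F(cx_1,cx_2,\dots)$. Convergence: $F_N\in\mathrm{Sym}(N)$ converges to $F\in\mathrm{Sym}$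 if $\sup_N\deg F_N<\infty$ and, for every sufficiently large $d$, $\iota_{d,N}(F_N)\to F$ in the finite-dimensional space $\mathrm{Sym}_{\le d}$, where for $N\ge d$, $\iota_{d,N}:\mathrm{Sym}_{\le d}(N)\to\mathrm{Sym}_{\le d}$ is the inverse of the isomorphism $F\mapsto F(x_1,\dots,x_N,0,0,\dots)$. Univariate $q$-Meixner polynomials (monic of degree $n$): $$\varphi^{qM}_n(x;q;a,c,d)=\left(\frac{cq}a;q\right)_n\left(\frac a{cdq^n}\right)^n{}_2\phi_1\!\left[\begin{matrix}q^{-n},\;cx\\ cq/a\end{matrix}\Big|\,q;\frac daq^{n+1}\right],$$ with base $q$ and argument $\frac daq^{n+1}$. $N$-variate polynomials: for $\lambda\in\mathbb Y(N)$, $$\varphi^{qM}_{\lambda|N}(x_1,\dots,x_N;q;a,cq^{1-N},dq^{1-N})=\frac{\det[\varphi^{qM}_{\lambda_i+N-i}(x_j;q;a,cq^{1-N},dq^{1-N})]_{i,j=1}^N}{V(x_1,\dots,x_N)}.$$ Interpolation functions: $(x\mid c_0,c_1,\dots)^m=\prod_{i=0}^{m-1}(x-c_i)$; for $\mu\in\mathbb Y(N)$, $s_{\mu|N}(x_1,\dots,x_N\mid c_0,c_1,\dots)=\det[(x_j\mid c_0,c_1,\dots)^{\mu_i+N-i}]_{i,j=1}^N/V(x_1,\dots,x_N)$; $I^A_\mu(\cdot;q)\in\mathrm{Sym}$ is the limit as $N\to\infty$ (which exists) of $s_{\mu|N}(\cdot\mid q^{N-1},q^{N-2},\dots)$. $q$-Meixner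 symmetric functions: $\Phi^{qM}_\lambda(X;q;a,c,d)=\sum_{\mu\subseteq\lambda}\sigma^{qM}(\lambda,\mu;q;a,c,d)\,I^A_\mu(Xc;q)$ with $$\sigma^{qM}(\lambda,\mu;q;a,c,d)=c^{-|\lambda|}\left(\frac a{qd}\right)^{|\lambda|-|\mu|}q^{2\{n(\mu')-n(\mu)-n(\lambda')+n(\lambda)\}}\det\left[\frac{\left(\frac caq^{\mu_k+2-k};q\right)_{\lambda_j-j-\mu_k+k}}{(q;q)_{\lambda_j-j-\mu_k+k}}\right]_{j,k=1}^{\ell(\lambda)};$$ an entry with $\lambda_j-j-\mu_k+k<0$ is $0$, and the empty determinant is $1$. *)

theory Defs
  imports
    "HOL-Analysis.Function_Topology"
    "HOL-Combinatorics.Permutations"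
    "HOL-Computational_Algebra.Polynomial"
    "HOL-Library.Poly_Mapping"
    "Jordan_Normal_Form.Determinant"
begin

section \<open>Partitions\<close>

text \<open>
  A partition is a sequence of type \<open>nat \<Rightarrow> nat\<close>, indexed from 0: the part written
  \<open>\<lambda>\<^sub>i\<close> on paper (with \<open>i \<ge> 1\<close>) is \<open>lam (i - 1)\<close>. Containment of Young diagrams is the pointwise
  order on functions.
\<close>

definition is_partition :: "(nat \<Rightarrow> nat) \<Rightarrow> bool" where
  "is_partition lam \<longleftrightarrow> antimono lam \<and> finite {i. lam i \<noteq> 0}"

definition plength :: "(nat \<Rightarrow> nat) \<Rightarrow> nat" where
  "plength lam = card {i. lam i \<noteq> 0}"

definition psize :: "(nat \<Rightarrow> nat) \<Rightarrow> nat" where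
  "psize lam = (\<Sum>i<plength lam. lam i)"

definition pweight :: "(nat \<Rightarrow> nat) \<Rightarrow> nat" where  \<comment> \<open>the statistic \<open>n(\<lambda>)\<close>\<close>
  "pweight lam = (\<Sum>i<plength lam. i * lam i)"

definition ptranspose :: "(nat \<Rightarrow> nat) \<Rightarrow> (nat \<Rightarrow> nat)" where
  "ptranspose lam = (\<lambda>j. card {i. j < lam i})"


section \<open>Symmetric polynomials and symmetric functions\<close>

text \<open>
  Monomials in the variables \<open>x\<^sub>1, x\<^sub>2, \<dots>\<close> are exponent vectors \<open>nat \<Rightarrow>\<^sub>0 nat\<close>, the variable
  \<open>x\<^sub>i\<close> having index \<open>i - 1\<close>. Polynomials are finitely supported coefficient functions on
  monomials, with the convolution product of \<open>Poly_Mapping\<close>. Elements of \<open>Sym\<close> are formal series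
  of bounded degree, i.e. arbitrary coefficient functions on monomials subject to the
  conditions in \<open>Sym_upto\<close>.
\<close>

type_synonym monom = "nat \<Rightarrow>\<^sub>0 nat"
type_synonym mpol = "monom \<Rightarrow>\<^sub>0 complex"
type_synonym symfun = "monom \<Rightarrow> complex"

definition mdeg :: "monom \<Rightarrow> nat" where
  "mdeg m = (\<Sum>i\<in>Poly_Mapping.keys m. Poly_Mapping.lookup m i)"

definition Const :: "complex \<Rightarrow> mpol" where
  "Const z = Poly_Mapping.single 0 z"

definition Var :: "nat \<Rightarrow> mpol" where
  "Var i = Poly_Mapping.single (Poly_Mapping.single i 1) 1"

text \<open>\<open>Symp_upto d N\<close> is \<open>Sym(N)\<^bsub>\<le>d\<^esub>\<close> and \<open>Sym_upto d\<close> is \<open>Sym\<^bsub>\<le>d\<^esub>\<close>.\<close>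

definition Symp_upto :: "nat \<Rightarrow> nat \<Rightarrow> mpol set" where
  "Symp_upto d N = {P. (\<forall>m\<in>Poly_Mapping.keys P. Poly_Mapping.keys m \<subseteq> {..<N} \<and> mdeg m \<le> d) \<and>
     (\<forall>\<pi> m. \<pi> permutes {..<N} \<longrightarrow> Poly_Mapping.lookup P (Poly_Mapping.map_key \<pi> m) = Poly_Mapping.lookup P m)}"

definition Sym_upto :: "nat \<Rightarrow> symfun set" where
  "Sym_upto d = {F. (\<forall>m. F m \<noteq> 0 \<longrightarrow> mdeg m \<le> d) \<and>
     (\<forall>\<pi> m. bij \<pi> \<longrightarrow> F (Poly_Mapping.map_key \<pi> m) = F m)}"

definition Sym :: "symfun set" where
  "Sym = (\<Union>d. Sym_upto d)"

definition specialize :: "nat \<Rightarrow> symfun \<Rightarrow> mpol" where  \<comment> \<open>\<open>F(x\<^sub>1, \<dots>, x\<^sub>N, 0, 0, \<dots>)\<close>\<close>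
  "specialize N F = Abs_poly_mapping (\<lambda>m. if Poly_Mapping.keys m \<subseteq> {..<N} then F m else 0)"

definition rescale :: "complex \<Rightarrow> symfun \<Rightarrow> symfun" where  \<comment> \<open>\<open>F(Xc)\<close>\<close>
  "rescale c F = (\<lambda>m. c ^ mdeg m * F m)"

definition lift_sym :: "nat \<Rightarrow> nat \<Rightarrow> mpol \<Rightarrow> symfun" where  \<comment> \<open>\<open>\<iota>\<^bsub>d,N\<^esub>\<close>, for \<open>N \<ge> d\<close>\<close>
  "lift_sym d N = inv_into (Sym_upto d) (specialize N)"

text \<open>
  Convergence of a sequence \<open>F\<^sub>N \<in> Sym(N)\<close>, given for \<open>N \<ge> N0\<close>, to \<open>L \<in> Sym\<close>. The limit is taken in
  the product topology on \<open>symfun\<close>; this is a Hausdorff vector space topology, so on the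
  finite-dimensional subspace \<open>Sym_upto d\<close> it induces the standard one. The degree bound \<open>D\<close> is
  what makes \<open>lift_sym d N (F N)\<close> meaningful once \<open>D \<le> d\<close> and \<open>d \<le> N\<close>.
\<close>

definition sym_converges :: "nat \<Rightarrow> (nat \<Rightarrow> mpol) \<Rightarrow> symfun \<Rightarrow> bool" where
  "sym_converges N0 F L \<longleftrightarrow> L \<in> Sym \<and>
     (\<exists>D. (\<forall>N\<ge>N0. F N \<in> Symp_upto D N) \<and>
          (\<exists>d0\<ge>D. \<forall>d\<ge>d0. L \<in> Sym_upto d \<and> (\<lambda>N. lift_sym d N (F N)) \<longlonglongrightarrow> L))"


section \<open>Ratios of alternants\<close>

definition vandermonde :: "nat \<Rightarrow> mpol" where
  "vandermonde N = (\<Prod>(i, j)\<in>{(i, j). i < j \<and> j < N}. Var i - Var j)"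

text \<open>
  \<open>multivariate p lam N\<close> is \<open>det [p\<^bsub>\<lambda>\<^sub>i + N - i\<^esub>(x\<^sub>j)] / V(x\<^sub>1, \<dots>, x\<^sub>N)\<close> for a sequence \<open>p\<close> of univariate
  polynomials. The quotient is unique as \<open>mpol\<close> is an integral domain; it exists because the
  determinant is alternating in the variables.
\<close>

definition alternant :: "(nat \<Rightarrow> complex poly) \<Rightarrow> (nat \<Rightarrow> nat) \<Rightarrow> nat \<Rightarrow> mpol" where
  "alternant p lam N =
     Determinant.det (Matrix.mat N N (\<lambda>(i, j). poly (map_poly Const (p (lam i + N - 1 - i))) (Var j)))"

definition multivariate :: "(nat \<Rightarrow> complex poly) \<Rightarrow> (nat \<Rightarrow> nat) \<Rightarrow> nat \<Rightarrow> mpol" where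
  "multivariate p lam N = (THE P. P * vandermonde N = alternant p lam N)"


section \<open>The $q$-Meixner polynomials\<close>

definition qpoch :: "'a::comm_ring_1 \<Rightarrow> 'a \<Rightarrow> nat \<Rightarrow> 'a" where
  "qpoch x q n = (\<Prod>k<n. 1 - x * q ^ k)"

definition phi21 :: "complex \<Rightarrow> complex \<Rightarrow> complex \<Rightarrow> complex \<Rightarrow> complex \<Rightarrow> complex" where
  "phi21 \<alpha> \<beta> \<gamma> q z =
     suminf (\<lambda>k. qpoch \<alpha> q k * qpoch \<beta> q k / (qpoch \<gamma> q k * qpoch q q k) * z ^ k)"

text \<open>
  The series terminates at \<open>k = n\<close> because of the parameter \<open>q\<^sup>-\<^sup>n\<close>, so it is a polynomial in the
  argument \<open>x\<close>; the factor \<open>qpoch [:0, c:] [:q:] k\<close> is \<open>(cx; q)\<^sub>k\<close> as a polynomial in \<open>x\<close>.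
  See \<open>poly_qMeixner\<close>.
\<close>

definition qMeixner :: "complex \<Rightarrow> complex \<Rightarrow> complex \<Rightarrow> complex \<Rightarrow> nat \<Rightarrow> complex poly" where
  "qMeixner q a c d n =
     smult (qpoch (c * q / a) q n * (a / (c * d * q ^ n)) ^ n)
       (\<Sum>k\<le>n. smult (qpoch (q powi (- int n)) q k / (qpoch (c * q / a) q k * qpoch q q k)
                       * (d / a * q ^ (n + 1)) ^ k)
                 (qpoch [:0, c:] [:q:] k))"

lemma poly_qpoch: "poly (qpoch p r k) x = qpoch (poly p x) (poly r x) k"
  by (simp add: qpoch_def poly_prod)

lemma poly_qMeixner:
  assumes "q \<noteq> 0"
  shows "poly (qMeixner q a c d n) x =
    qpoch (c * q / a) q n * (a / (c * d * q ^ n)) ^ n *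
      phi21 (q powi (- int n)) (c * x) (c * q / a) q (d / a * q ^ (n + 1))"
proof -
  have "qpoch (q powi (- int n)) q k = 0" if "n < k" for k
    unfolding qpoch_def using that assms
    by (intro prod_zero) (auto simp: power_int_minus intro!: bexI[of _ n])
  hence "phi21 (q powi (- int n)) (c * x) (c * q / a) q (d / a * q ^ (n + 1)) =
      (\<Sum>k\<le>n. qpoch (q powi (- int n)) q k * qpoch (c * x) q k /
        (qpoch (c * q / a) q k * qpoch q q k) * (d / a * q ^ (n + 1)) ^ k)"
    unfolding phi21_def by (intro suminf_finite) auto
  thus ?thesis
    by (simp add: qMeixner_def poly_sum poly_qpoch mult_ac)
qed

text \<open>\<open>qMeixner_multi lam N q a c d\<close> is \<open>\<phi>\<^bsub>\<lambda>|N\<^esub>(x\<^sub>1, \<dots>, x\<^sub>N; q; a, c, d)\<close>, without any \<open>N\<close>-dependent shift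
  of the parameters.\<close>

definition qMeixner_multi ::
    "(nat \<Rightarrow> nat) \<Rightarrow> nat \<Rightarrow> complex \<Rightarrow> complex \<Rightarrow> complex \<Rightarrow> complex \<Rightarrow> mpol" where
  "qMeixner_multi lam N q a c d = multivariate (qMeixner q a c d) lam N"


section \<open>Interpolation functions and the $q$-Meixner symmetric functions\<close>

definition genpow :: "(nat \<Rightarrow> complex) \<Rightarrow> nat \<Rightarrow> complex poly" where  \<comment> \<open>\<open>(x | c\<^sub>0, c\<^sub>1, \<dots>)\<^sup>m\<close>\<close>
  "genpow cs m = (\<Prod>i<m. [:- cs i, 1:])"

definition interp_poly :: "(nat \<Rightarrow> nat) \<Rightarrow> nat \<Rightarrow> (nat \<Rightarrow> complex) \<Rightarrow> mpol" where
  "interp_poly mu N cs = multivariate (genpow cs) mu N"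

text \<open>The node sequence \<open>q\<^sup>N\<^sup>-\<^sup>1, q\<^sup>N\<^sup>-\<^sup>2, \<dots>\<close> does not stop at \<open>q\<^sup>0\<close> but continues with negative powers.
  Limits in the sense of \<open>sym_converges\<close> are unique.\<close>

definition interp_sym :: "(nat \<Rightarrow> nat) \<Rightarrow> complex \<Rightarrow> symfun" where
  "interp_sym mu q = (THE L. sym_converges (plength mu)
     (\<lambda>N. interp_poly mu N (\<lambda>i. q powi (int N - 1 - int i))) L)"

text \<open>With rows and columns indexed from 0, the index \<open>\<lambda>\<^sub>j - j - \<mu>\<^sub>k + k\<close> keeps its form, while
  the exponent \<open>\<mu>\<^sub>k + 2 - k\<close> becomes \<open>\<mu>\<^sub>k + 1 - k\<close>.\<close>

definition sigma_entry ::
    "(nat \<Rightarrow> nat) \<Rightarrow> (nat \<Rightarrow> nat) \<Rightarrow> complex \<Rightarrow> complex \<Rightarrow> complex \<Rightarrow> nat \<Rightarrow> nat \<Rightarrow> complex" where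
  "sigma_entry lam mu q a c j k =
     (let r = int (lam j) - int j - int (mu k) + int k in
      if r < 0 then 0
      else qpoch (c / a * q powi (int (mu k) + 1 - int k)) q (nat r) / qpoch q q (nat r))"

definition sigma_qM ::
    "(nat \<Rightarrow> nat) \<Rightarrow> (nat \<Rightarrow> nat) \<Rightarrow> complex \<Rightarrow> complex \<Rightarrow> complex \<Rightarrow> complex \<Rightarrow> complex" where
  "sigma_qM lam mu q a c d =
     c powi (- int (psize lam)) * (a / (q * d)) powi (int (psize lam) - int (psize mu))
     * q powi (2 * (int (pweight (ptranspose mu)) - int (pweight mu)
                    - int (pweight (ptranspose lam)) + int (pweight lam)))
     * Determinant.det (Matrix.mat (plength lam) (plength lam) (\<lambda>(j, k). sigma_entry lam mu q a c j k))"

definition qMeixner_sym ::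
    "(nat \<Rightarrow> nat) \<Rightarrow> complex \<Rightarrow> complex \<Rightarrow> complex \<Rightarrow> complex \<Rightarrow> symfun" where
  "qMeixner_sym lam q a c d =
     (\<lambda>m. \<Sum>mu | is_partition mu \<and> mu \<le> lam.
            sigma_qM lam mu q a c d * rescale c (interp_sym mu q) m)"

definition admissible :: "real \<Rightarrow> real \<Rightarrow> complex \<Rightarrow> complex \<Rightarrow> bool" where
  "admissible q a c d \<longleftrightarrow> a > 0 \<and>
     ((d = cnj c \<and> c \<notin> \<real>) \<or>
      (\<exists>c' d'::real. c = of_real c' \<and> d = of_real d' \<and>
         ((\<exists>m::int. a * q powi m < c' \<and> c' < a * q powi (m - 1) \<and>
                    a * q powi m < d' \<and> d' < a * q powi (m - 1)) \<or>
          (c' < 0 \<and> d' < 0 \<and> q < c' / d' \<and> c' / d' < 1 / q))))"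

text \<open>The index set of the sum in \<open>qMeixner_sym\<close> is finite, so that sum is not degenerate.\<close>

lemma finite_subpartitions:
  assumes "is_partition lam"
  shows "finite {mu. is_partition mu \<and> mu \<le> lam}"
proof -
  have fin: "finite {i. lam i \<noteq> 0}" using assms by (simp add: is_partition_def)
  have "finite {f. \<forall>i. (i \<in> {i. lam i \<noteq> 0} \<longrightarrow> f i \<in> {..lam 0}) \<and> (i \<notin> {i. lam i \<noteq> 0} \<longrightarrow> f i = 0)}"
    by (rule finite_set_of_finite_funs) (use fin in auto)
  moreover have "{mu. is_partition mu \<and> mu \<le> lam} \<subseteq>
      {f. \<forall>i. (i \<in> {i. lam i \<noteq> 0} \<longrightarrow> f i \<in> {..lam 0}) \<and> (i \<notin> {i. lam i \<noteq> 0} \<longrightarrow> f i = 0)}"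
  proof -
    have "mu i \<le> lam 0" "lam i = 0 \<Longrightarrow> mu i = 0" if "mu \<le> lam" for mu i
    proof -
      have "mu i \<le> lam i" using that by (simp add: le_fun_def)
      moreover have "lam i \<le> lam 0" using assms by (simp add: is_partition_def antimono_def)
      ultimately show "mu i \<le> lam 0" "lam i = 0 \<Longrightarrow> mu i = 0" by auto
    qed
    thus ?thesis by auto
  qed
  ultimately show ?thesis by (rule rev_finite_subset)
qed

end

theory Submission
  imports Defs
begin

text \<open>
  Since \<open>(cq\<^sup>1\<^sup>-\<^sup>Nx; q)\<^sub>k\<close> is, up to a constant, the shifted power of \<open>x\<close> with nodes \<open>c\<^sup>-\<^sup>1q\<^sup>N\<^sup>-\<^sup>1, c\<^sup>-\<^sup>1q\<^sup>N\<^sup>-\<^sup>2, \<dots>\<close>,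
  the univariate polynomials are a unitriangular combination of these shifted powers. By the
  Cauchy-Binet formula the \<open>N\<close>-variate polynomials are a combination, over \<open>\<mu> \<subseteq> \<lambda>\<close>, of
  the interpolation polynomials at \<open>cx\<close>, with minors of the transition matrix as coefficients. A
  minor reduces to size \<open>\<ell>(\<lambda>)\<close>, and after extracting row and column factors its entries no longer
  depend on \<open>N\<close>: it equals \<open>\<sigma>(\<lambda>, \<mu>)\<close> times a quotient of \<open>q\<close>-factorials that tends to 1.
  The same argument expands the interpolation polynomials in Schur polynomials, with
  coefficients built from elementary symmetric polynomials in \<open>q\<^sup>s, \<dots>, q\<^sup>N\<^sup>-\<^sup>1\<close>, where \<open>s\<close> does not
  depend on \<open>N\<close>; these converge. Schur polynomials are stable in \<open>N\<close>, so convergence of the Schur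
  coefficients is convergence in \<open>Sym\<close>.
\<close>

section \<open>Determinants and the Cauchy-Binet formula\<close>

text \<open>Neither side comes with coordinates: \<open>lift_sym\<close> is an inverse chosen by
  \<open>inv_into\<close>, and \<open>interp_sym\<close> is a limit chosen by \<open>THE\<close>.
  Expansions over pairs nu \<le> mu \<le> lam, an index set free of N, supply coordinates for both.
  N leaves the minors because the shift q^(1-N) of c and d offsets the staircase N - 1 - k in the
  indices. It does so in the base of the q-Pochhammer entries, and also in the exponent (2N - 2)n -
  n^2 = (N-1)^2 - (n-N+1)^2, where n - N + 1 is a part minus its index. The q-factorials come from
  rewriting (q^-n; q)_k; their two indices grow with a fixed difference. The scale c is accounted
  for as follows: nodes divided by c contribute c^(|nu|-|mu|). Homogeneity of Schur functions turns
  c^|nu| into the dilation by c, and c^(-|mu|) cancels against the c^|mu| that the normalization of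
  the univariate polynomials leaves over.\<close>

abbreviation fdet :: "nat \<Rightarrow> (nat \<Rightarrow> nat \<Rightarrow> 'a::comm_ring_1) \<Rightarrow> 'a" where
  "fdet n f \<equiv> Determinant.det (Matrix.mat n n (\<lambda>(i, j). f i j))"

lemma fdet_leibniz:
  "fdet n f = (\<Sum>p | p permutes {0..<n}. signof p * (\<Prod>i=0..<n. f i (p i)))"
proof -
  have "fdet n f = (\<Sum>p | p permutes {0..<n}. signof p *
      (\<Prod>i=0..<n. Matrix.mat n n (\<lambda>(i, j). f i j) $$ (i, p i)))"
    by (rule det_def') simp
  also have "\<dots> = (\<Sum>p | p permutes {0..<n}. signof p * (\<Prod>i=0..<n. f i (p i)))"
  proof (intro sum.cong refl arg_cong2[where f = "(*)"] prod.cong)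
    fix p i assume "p \<in> {p. p permutes {0..<n}}" "i \<in> {0..<n}"
    moreover from this have "p i \<in> {0..<n}" by (simp only: permutes_in_image mem_Collect_eq)
    ultimately show "Matrix.mat n n (\<lambda>(i, j). f i j) $$ (i, p i) = f i (p i)" by simp
  qed
  finally show ?thesis .
qed

lemma fdet_cong:
  assumes "\<And>i j. i < n \<Longrightarrow> j < n \<Longrightarrow> f i j = g i j"
  shows "fdet n f = fdet n g"
  by (intro arg_cong[of _ _ Determinant.det] eq_matI) (use assms in auto)

text \<open>Every Leibniz term meets each row and each column exactly once. This is how the
  N-dependent factors leave a minor.\<close>

lemma fdet_scale_rows_columns:
  "fdet n (\<lambda>i j. r i * f i j * s j) = (\<Prod>i<n. r i) * (\<Prod>j<n. s j) * fdet n f"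
proof -
  have "signof p * (\<Prod>i=0..<n. r i * f i (p i) * s (p i)) =
      (\<Prod>i<n. r i) * (\<Prod>j<n. s j) * (signof p * (\<Prod>i=0..<n. f i (p i)))"
    if p: "p permutes {0..<n}" for p
  proof -
    have "(\<Prod>i=0..<n. s (p i)) = (\<Prod>j=0..<n. s j)"
      using prod.permute[OF p, of s] by (simp add: o_def)
    thus ?thesis by (simp add: prod.distrib lessThan_atLeast0 mult_ac)
  qed
  thus ?thesis
    by (simp only: fdet_leibniz sum_distrib_left) (intro sum.cong refl, simp)
qed

lemma fdet_permute_rows:
  assumes "p permutes {0..<n}"
  shows "fdet n (\<lambda>i. f (p i)) = signof p * fdet n f"
proof -
  have "fdet n (\<lambda>i. f (p i)) =
      Determinant.det (Matrix.mat n n (\<lambda>(i, j). Matrix.mat n n (\<lambda>(i, j). f i j) $$ (p i, j)))"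
  proof (intro arg_cong[of _ _ Determinant.det] eq_matI)
    fix i j assume "i < dim_row (Matrix.mat n n (\<lambda>(i, j). Matrix.mat n n (\<lambda>(i, j). f i j) $$ (p i, j)))"
      "j < dim_col (Matrix.mat n n (\<lambda>(i, j). Matrix.mat n n (\<lambda>(i, j). f i j) $$ (p i, j)))"
    moreover from this have "p i < n" using permutes_in_image[OF assms, of i] by simp
    ultimately show "Matrix.mat n n (\<lambda>(i, j). f (p i) j) $$ (i, j) =
        Matrix.mat n n (\<lambda>(i, j). Matrix.mat n n (\<lambda>(i, j). f i j) $$ (p i, j)) $$ (i, j)"
      by simp
  qed auto
  also have "\<dots> = signof p * fdet n f"
    by (rule det_permute_rows[OF _ assms]) simp
  finally show ?thesis .
qed

lemma fdet_transpose: "fdet n (\<lambda>i j. f j i) = fdet n f"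
proof -
  have "fdet n (\<lambda>i j. f j i) = Determinant.det (transpose_mat (Matrix.mat n n (\<lambda>(i, j). f i j)))"
    by (intro arg_cong[of _ _ Determinant.det] eq_matI) auto
  thus ?thesis by (simp add: det_transpose[of _ n])
qed

lemma fdet_permute_columns:
  assumes "p permutes {0..<n}"
  shows "fdet n (\<lambda>i j. f i (p j)) = signof p * fdet n f"
  using fdet_permute_rows[OF assms, of "\<lambda>i j. f j i"] by (simp add: fdet_transpose[of n f]
    fdet_transpose[of n "\<lambda>i j. f i (p j)", symmetric])

lemma fdet_identical_rows:
  assumes "i < n" "j < n" "i \<noteq> j" "f i = f j"
  shows "fdet n f = 0"
  by (rule det_identical_rows[of _ n i j]) (use assms in \<open>auto intro!: eq_vecI\<close>)

lemma fdet_Suc_row: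
  assumes "\<And>k. k < n \<Longrightarrow> f n k = 0"
  shows "fdet (Suc n) f = f n n * fdet n f"
proof -
  let ?A = "Matrix.mat (Suc n) (Suc n) (\<lambda>(i, j). f i j)"
  have "fdet (Suc n) f = (\<Sum>j<Suc n. ?A $$ (n, j) * cofactor ?A n j)"
    by (rule laplace_expansion_row) auto
  also have "\<dots> = f n n * cofactor ?A n n"
    using assms by (simp add: sum.neutral)
  also have "cofactor ?A n n = Determinant.det (mat_delete ?A n n)"
    by (simp add: cofactor_def flip: mult_2)
  also have "mat_delete ?A n n = Matrix.mat n n (\<lambda>(i, j). f i j)"
    by (intro eq_matI) (auto simp: mat_delete_def)
  finally show ?thesis .
qed

lemma fdet_Suc_column:
  assumes "\<And>k. k < n \<Longrightarrow> f k n = 0"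
  shows "fdet (Suc n) f = f n n * fdet n f"
  using fdet_Suc_row[of n "\<lambda>i j. f j i"] assms fdet_transpose[of n f] fdet_transpose[of "Suc n" f]
  by simp

text \<open>From row l on the matrix is upper unitriangular, so Laplace expansion along the last row
  peels off one row at a time. It cuts minors of growing size N down to a fixed size.\<close>

lemma fdet_reduce:
  assumes "l \<le> n" "\<And>i k. l \<le> i \<Longrightarrow> i < n \<Longrightarrow> k < i \<Longrightarrow> f i k = 0"
    and "\<And>i. l \<le> i \<Longrightarrow> i < n \<Longrightarrow> f i i = 1"
  shows "fdet n f = fdet l f"
  using assms
proof (induction n rule: dec_induct)
  case (step n)
  have "fdet (Suc n) f = f n n * fdet n f"
    by (rule fdet_Suc_row) (use step in auto)
  thus ?case using step by simp
qed simp

lemma fdet_upper_unitriangular: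
  assumes "\<And>i k. i < n \<Longrightarrow> k < i \<Longrightarrow> f i k = 0" "\<And>i. i < n \<Longrightarrow> f i i = 1"
  shows "fdet n f = 1"
  using fdet_reduce[of 0 n f] assms by simp

text \<open>A nonzero Leibniz term would inject the n - r rows from r on into the n - r - 1 columns
  after r. This kills the minors with mu not contained in lam.\<close>

lemma fdet_zero_block:
  assumes r: "r < n" and zero: "\<And>i k. r \<le> i \<Longrightarrow> i < n \<Longrightarrow> k \<le> r \<Longrightarrow> f i k = 0"
  shows "fdet n f = 0"
proof -
  have "(\<Prod>i=0..<n. f i (p i)) = 0" if p: "p permutes {0..<n}" for p
  proof (rule ccontr)
    assume *: "(\<Prod>i=0..<n. f i (p i)) \<noteq> 0"
    have "p i \<in> {Suc r..<n}" if "i \<in> {r..<n}" for i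
    proof -
      have "p i < n" using permutes_in_image[OF p, of i] that by simp
      moreover have "\<not> p i \<le> r"
      proof
        assume "p i \<le> r"
        hence "f i (p i) = 0" using zero[of i "p i"] that by simp
        hence "(\<Prod>i=0..<n. f i (p i)) = 0" by (intro prod_zero) (use that in auto)
        with * show False by contradiction
      qed
      ultimately show ?thesis by simp
    qed
    hence "p ` {r..<n} \<subseteq> {Suc r..<n}" by blast
    moreover have "inj_on p {r..<n}" using permutes_inj[OF p] by (rule inj_on_subset) simp
    ultimately have "card {r..<n} \<le> card {Suc r..<n}" by (intro card_inj_on_le) auto
    thus False using r by simp
  qed
  thus ?thesis by (simp add: fdet_leibniz)
qed

lemma tendsto_fdet:
  fixes f :: "'b \<Rightarrow> nat \<Rightarrow> nat \<Rightarrow> complex"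
  assumes "\<And>i j. i < n \<Longrightarrow> j < n \<Longrightarrow> ((\<lambda>x. f x i j) \<longlongrightarrow> g i j) F"
  shows "((\<lambda>x. fdet n (f x)) \<longlongrightarrow> fdet n g) F"
  unfolding fdet_leibniz
proof (intro tendsto_sum tendsto_mult tendsto_const tendsto_prod)
  fix p i assume "p \<in> {p. p permutes {0..<n}}" "i \<in> {0..<n}"
  moreover from this have "p i \<in> {0..<n}" by (simp only: permutes_in_image mem_Collect_eq)
  ultimately show "((\<lambda>x. f x i (p i)) \<longlongrightarrow> g i (p i)) F" using assms by simp
qed

lemma hom_fdet:
  assumes "comm_ring_hom h"
  shows "h (fdet n f) = fdet n (\<lambda>i j. h (f i j))"
proof -
  have "h (fdet n f) = Determinant.det (map_mat h (Matrix.mat n n (\<lambda>(i, j). f i j)))"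
    by (rule comm_ring_hom.hom_det[OF assms, symmetric])
  also have "map_mat h (Matrix.mat n n (\<lambda>(i, j). f i j)) = Matrix.mat n n (\<lambda>(i, j). h (f i j))"
    by (intro eq_matI) auto
  finally show ?thesis .
qed

section \<open>Partitions as sets of column indices\<close>

definition beta :: "nat \<Rightarrow> (nat \<Rightarrow> nat) \<Rightarrow> nat \<Rightarrow> nat" where  \<comment> \<open>\<open>\<mu>\<^sub>i + N - i\<close>; with \<open>i = k + 1\<close>, meaningful only for \<open>k < N\<close>\<close>
  "beta N mu k = mu k + N - 1 - k"

text \<open>These encode the N-element subsets of \<open>{..<M}\<close>, listed decreasingly by
  \<open>beta N mu\<close>. Requiring zeros from N on makes mu determined by the subset.\<close>

definition box_partitions :: "nat \<Rightarrow> nat \<Rightarrow> (nat \<Rightarrow> nat) set" where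
  "box_partitions N M = {mu. antimono mu \<and> (\<forall>i\<ge>N. mu i = 0) \<and> (\<forall>i<N. beta N mu i < M)}"

lemma beta_strict_decreasing:
  assumes "antimono mu" "i < j" "j < N"
  shows "beta N mu j < beta N mu i"
  using antimonoD[OF assms(1), of i j] assms(2,3) by (simp add: beta_def)

lemma inj_on_beta:
  assumes "antimono mu"
  shows "inj_on (beta N mu) {0..<N}"
proof (rule linorder_inj_onI)
  fix i j assume "i < j" "i \<in> {0..<N}" "j \<in> {0..<N}"
  thus "beta N mu i \<noteq> beta N mu j" using beta_strict_decreasing[OF assms, of i j N] by auto
qed auto

text \<open>The position of an element in a decreasing list is the number of larger elements, so the
  set alone determines the list.\<close>

lemma beta_rank:
  assumes "antimono mu" "k < N"
  shows "card {x \<in> beta N mu ` {0..<N}. beta N mu k < x} = k"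
proof -
  have "{x \<in> beta N mu ` {0..<N}. beta N mu k < x} = beta N mu ` {0..<k}"
  proof (intro equalityI subsetI)
    fix x assume "x \<in> {x \<in> beta N mu ` {0..<N}. beta N mu k < x}"
    then obtain i where i: "i < N" "x = beta N mu i" "beta N mu k < beta N mu i" by auto
    have "\<not> k \<le> i"
      using beta_strict_decreasing[OF assms(1), of k i N] i by (cases "i = k") auto
    thus "x \<in> beta N mu ` {0..<k}" using i by auto
  qed (use assms beta_strict_decreasing[OF assms(1), of _ k N] in auto)
  moreover have "inj_on (beta N mu) {0..<k}"
    using inj_on_beta[OF assms(1)] by (rule inj_on_subset) (use assms in auto)
  ultimately show ?thesis by (simp add: card_image)
qed

lemma beta_image_inject:
  assumes "antimono mu" "antimono nu" "beta N mu ` {0..<N} = beta N nu ` {0..<N}" "k < N"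
  shows "beta N mu k = beta N nu k"
proof -
  obtain j where j: "j < N" "beta N mu k = beta N nu j"
    using assms(3,4) by (metis (no_types, lifting) atLeastLessThan_iff imageE imageI le0)
  have "k = card {x \<in> beta N mu ` {0..<N}. beta N mu k < x}"
    by (rule beta_rank[OF assms(1,4), symmetric])
  also have "\<dots> = card {x \<in> beta N nu ` {0..<N}. beta N nu j < x}" by (simp only: j assms(3))
  also have "\<dots> = j" by (rule beta_rank[OF assms(2) j(1)])
  finally show ?thesis using j by simp
qed

lemma beta_inject:
  assumes "\<forall>i\<ge>N. mu i = 0" "\<forall>i\<ge>N. nu i = 0" "\<And>k. k < N \<Longrightarrow> beta N mu k = beta N nu k"
  shows "mu = nu"
proof
  fix k show "mu k = nu k"
    using assms(1,2) assms(3)[of k] by (cases "k < N") (auto simp: beta_def)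
qed

text \<open>Sort S decreasingly and subtract the staircase N - 1, ..., 1, 0.\<close>

lemma finite_set_eq_beta_image:
  assumes "finite S" "card S = N"
  obtains mu where "antimono mu" "\<forall>i\<ge>N. mu i = 0" "beta N mu ` {0..<N} = S"
proof -
  define g where "g k = rev (sorted_list_of_set S) ! k" for k
  define mu where "mu k = (if k < N then g k - (N - 1 - k) else 0)" for k
  have len: "length (rev (sorted_list_of_set S)) = N" by (simp add: assms)
  have img: "g ` {0..<N} = S"
  proof -
    have "g ` {0..<N} = (!) (rev (sorted_list_of_set S)) ` {0..<N}" by (simp add: g_def [abs_def])
    also have "\<dots> = set (take N (rev (sorted_list_of_set S)))" by (rule nth_image) (simp add: assms)
    finally show ?thesis using assms by simp
  qed
  have dec: "g (Suc k) < g k" if "Suc k < N" for k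
  proof -
    have "sorted_list_of_set S ! (N - Suc (Suc k)) < sorted_list_of_set S ! (N - Suc k)"
      by (rule sorted_wrt_nth_less[of "(<)"]) (use that assms in auto)
    thus ?thesis using that assms by (simp add: g_def rev_nth)
  qed
  \<comment> \<open>Each descent in the list loses at least 1, so entry k is at least N - 1 - k and
    the truncated subtraction in \<open>mu\<close> is a true one.\<close>
  have gap: "g (k + d) + d \<le> g k" if "k + d < N" for k d
    using that
  proof (induction d)
    case (Suc d)
    thus ?case using dec[of "k + d"] by simp
  qed simp
  have ge: "N - 1 - k \<le> g k" if "k < N" for k
    using gap[of k "N - 1 - k"] that by simp
  have "mu (Suc k) \<le> mu k" for k
    using dec[of k] ge[of k] ge[of "Suc k"] by (auto simp: mu_def)
  hence "antimono mu" by (simp add: decseq_SucI)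
  moreover have "beta N mu k = g k" if "k < N" for k
    using ge[OF that] that by (simp add: beta_def mu_def)
  hence "beta N mu ` {0..<N} = S" using img by auto
  moreover have "\<forall>i\<ge>N. mu i = 0" by (simp add: mu_def)
  ultimately show ?thesis using that by blast
qed

text \<open>An injective choice of N columns is its image, recorded by mu, together with an ordering
  of that image, recorded by p. The \<open>restrict\<close> produces the extensional functions that
  make up \<open>PiE\<close>.\<close>

lemma bij_betw_partition_permutation:
  "bij_betw (\<lambda>(mu, p). restrict (\<lambda>i. beta N mu (p i)) {0..<N})
     (box_partitions N M \<times> {p. p permutes {0..<N}})
     {f \<in> {0..<N} \<rightarrow>\<^sub>E {..<M}. inj_on f {0..<N}}"
proof (rule bij_betw_imageI)
  let ?F = "\<lambda>(mu, p). restrict (\<lambda>i. beta N mu (p i)) {0..<N}"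
  have lt: "p i < N" if "p permutes {0..<N}" "i < N" for p i
    using permutes_in_image[OF that(1), of i] that(2) by simp
  show "inj_on ?F (box_partitions N M \<times> {p. p permutes {0..<N}})"
  proof (rule inj_onI, clarify)
    fix mu p nu r
    assume mu: "mu \<in> box_partitions N M" and p: "p permutes {0..<N}"
      and nu: "nu \<in> box_partitions N M" and r: "r permutes {0..<N}"
      and eq: "restrict (\<lambda>i. beta N mu (p i)) {0..<N} = restrict (\<lambda>i. beta N nu (r i)) {0..<N}"
    have eqi: "beta N mu (p i) = beta N nu (r i)" if "i < N" for i
      using fun_cong[OF eq, of i] that by simp
    have "beta N mu ` {0..<N} = (\<lambda>i. beta N mu (p i)) ` {0..<N}"
      using permutes_image[OF p] by (metis image_image)
    also have "\<dots> = (\<lambda>i. beta N nu (r i)) ` {0..<N}" using eqi by (intro image_cong) auto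
    also have "\<dots> = beta N nu ` {0..<N}"
      using permutes_image[OF r] by (metis image_image)
    finally have "beta N mu k = beta N nu k" if "k < N" for k
      using beta_image_inject[of mu nu N k] mu nu that by (auto simp: box_partitions_def)
    hence mn: "mu = nu" by (rule beta_inject[rotated 2]) (use mu nu in \<open>auto simp: box_partitions_def\<close>)
    have "p i = r i" for i
    proof (cases "i < N")
      case True
      have "inj_on (beta N nu) {0..<N}" using nu by (intro inj_on_beta) (auto simp: box_partitions_def)
      thus ?thesis using eqi[OF True] lt[OF p True] lt[OF r True] mn by (auto dest: inj_onD)
    next
      case False
      thus ?thesis using p r by (simp add: permutes_def)
    qed
    with mn show "mu = nu \<and> p = r" by auto
  qed
  show "?F ` (box_partitions N M \<times> {p. p permutes {0..<N}}) =
      {f \<in> {0..<N} \<rightarrow>\<^sub>E {..<M}. inj_on f {0..<N}}"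
  proof (intro equalityI subsetI)
    fix f assume "f \<in> ?F ` (box_partitions N M \<times> {p. p permutes {0..<N}})"
    then obtain mu p where mu: "mu \<in> box_partitions N M" and p: "p permutes {0..<N}"
      and f: "f = restrict (\<lambda>i. beta N mu (p i)) {0..<N}" by auto
    have "f \<in> {0..<N} \<rightarrow>\<^sub>E {..<M}"
      using mu lt[OF p] by (auto simp: f box_partitions_def)
    moreover have "inj_on (beta N mu \<circ> p) {0..<N}"
      using mu permutes_inj_on[OF p] permutes_image[OF p]
      by (intro comp_inj_on) (auto simp: box_partitions_def intro: inj_on_beta)
    hence "inj_on f {0..<N}" by (auto simp: f inj_on_def)
    ultimately show "f \<in> {f \<in> {0..<N} \<rightarrow>\<^sub>E {..<M}. inj_on f {0..<N}}" by simp
  next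
    fix f assume "f \<in> {f \<in> {0..<N} \<rightarrow>\<^sub>E {..<M}. inj_on f {0..<N}}"
    hence f: "f \<in> {0..<N} \<rightarrow>\<^sub>E {..<M}" and inj: "inj_on f {0..<N}" by auto
    obtain mu where mu: "antimono mu" "\<forall>i\<ge>N. mu i = 0" "beta N mu ` {0..<N} = f ` {0..<N}"
      using finite_set_eq_beta_image[of "f ` {0..<N}" N] inj by (auto simp: card_image)
    have "bij_betw (beta N mu) {0..<N} (f ` {0..<N})"
      using mu inj_on_beta by (auto simp: bij_betw_def)
    hence "bij_betw (inv_into {0..<N} (beta N mu)) (f ` {0..<N}) {0..<N}"
      by (rule bij_betw_inv_into)
    hence bij: "bij_betw (inv_into {0..<N} (beta N mu) \<circ> f) {0..<N} {0..<N}"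
      by (rule bij_betw_trans[rotated]) (use inj in \<open>auto simp: bij_betw_def\<close>)
    define p where "p i = (if i < N then inv_into {0..<N} (beta N mu) (f i) else i)" for i
    have "bij_betw p {0..<N} {0..<N}"
      by (rule iffD1[OF bij_betw_cong bij]) (simp add: p_def)
    hence p: "p permutes {0..<N}" by (rule bij_imp_permutes) (simp add: p_def)
    have "beta N mu (p i) = f i" if "i < N" for i
      using that mu(3) by (auto simp: p_def intro!: f_inv_into_f)
    hence "f = restrict (\<lambda>i. beta N mu (p i)) {0..<N}"
      using f by (intro extensionalityI[of _ "{0..<N}"]) (auto simp: PiE_def)
    moreover have "mu \<in> box_partitions N M"
    proof -
      have "beta N mu i < M" if "i < N" for i
      proof -
        have "beta N mu i \<in> f ` {0..<N}" using mu(3) that by auto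
        thus ?thesis using f by auto
      qed
      thus ?thesis using mu by (auto simp: box_partitions_def)
    qed
    ultimately show "f \<in> ?F ` (box_partitions N M \<times> {p. p permutes {0..<N}})"
      using p by (intro image_eqI[of _ _ "(mu, p)"]) auto
  qed
qed

text \<open>Multiply out the row sums over choice functions f. For fixed f the sum over permutations
  is the determinant of the rows of B chosen by f, which vanishes unless f is injective. Splitting
  an injective f into its image and an ordering moves the sign of the ordering over to A, where it
  builds the minor of A.\<close>

theorem Cauchy_Binet:
  fixes A B :: "nat \<Rightarrow> nat \<Rightarrow> 'a::comm_ring_1"
  shows "fdet N (\<lambda>i j. \<Sum>k<M. A i k * B k j) =
    (\<Sum>mu\<in>box_partitions N M. fdet N (\<lambda>i k. A i (beta N mu k)) * fdet N (\<lambda>k. B (beta N mu k)))"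
proof -
  let ?P = "{p. p permutes {0..<N}}"
  let ?E = "{0..<N} \<rightarrow>\<^sub>E {..<M}"
  have fin: "finite ?E" by (intro finite_PiE) auto
  let ?G = "\<lambda>f. (\<Prod>i=0..<N. A i (f i)) * fdet N (\<lambda>i. B (f i))"
  have "fdet N (\<lambda>i j. \<Sum>k<M. A i k * B k j) =
      (\<Sum>p\<in>?P. signof p * (\<Sum>f\<in>?E. \<Prod>i=0..<N. A i (f i) * B (f i) (p i)))"
    unfolding fdet_leibniz
    by (intro sum.cong refl arg_cong2[where f = "(*)"] prod_sum_PiE) auto
  also have "\<dots> = (\<Sum>p\<in>?P. \<Sum>f\<in>?E. signof p * (\<Prod>i=0..<N. A i (f i) * B (f i) (p i)))"
    by (simp only: sum_distrib_left)
  also have "\<dots> = (\<Sum>f\<in>?E. \<Sum>p\<in>?P. signof p * (\<Prod>i=0..<N. A i (f i) * B (f i) (p i)))"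
    by (rule sum.swap)
  also have "\<dots> = (\<Sum>f\<in>?E. ?G f)"
    by (simp add: fdet_leibniz prod.distrib sum_distrib_left mult_ac)
  also have "\<dots> = (\<Sum>f\<in>{f\<in>?E. inj_on f {0..<N}}. ?G f)"
  proof (rule sum.mono_neutral_right[OF fin])
    show "\<forall>f\<in>?E - {f\<in>?E. inj_on f {0..<N}}. ?G f = 0"
    proof
      fix f assume "f \<in> ?E - {f\<in>?E. inj_on f {0..<N}}"
      hence "\<not> inj_on f {0..<N}" by blast
      then obtain i j where "i < N" "j < N" "i \<noteq> j" "f i = f j" by (auto simp: inj_on_def)
      hence "fdet N (\<lambda>i. B (f i)) = 0" by (intro fdet_identical_rows[of i N j]) auto
      thus "?G f = 0" by simp
    qed
  qed auto
  also have "\<dots> = (\<Sum>x\<in>box_partitions N M \<times> ?P.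
      ?G ((\<lambda>(mu, p). restrict (\<lambda>i. beta N mu (p i)) {0..<N}) x))"
    by (rule sum.reindex_bij_betw[OF bij_betw_partition_permutation, symmetric])
  also have "\<dots> = (\<Sum>mu\<in>box_partitions N M. \<Sum>p\<in>?P.
      ?G (restrict (\<lambda>i. beta N mu (p i)) {0..<N}))"
    by (simp add: sum.cartesian_product split_def)
  also have "\<dots> = (\<Sum>mu\<in>box_partitions N M. \<Sum>p\<in>?P.
      (signof p * (\<Prod>i=0..<N. A i (beta N mu (p i)))) * fdet N (\<lambda>k. B (beta N mu k)))"
  proof (intro sum.cong refl)
    fix mu p assume "p \<in> ?P"
    hence p: "p permutes {0..<N}" by simp
    have "fdet N (\<lambda>i. B (restrict (\<lambda>i. beta N mu (p i)) {0..<N} i)) = fdet N (\<lambda>i. B (beta N mu (p i)))"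
      by (rule fdet_cong) simp
    also have "\<dots> = signof p * fdet N (\<lambda>k. B (beta N mu k))"
      by (rule fdet_permute_rows[OF p])
    finally show "?G (restrict (\<lambda>i. beta N mu (p i)) {0..<N}) =
        (signof p * (\<Prod>i=0..<N. A i (beta N mu (p i)))) * fdet N (\<lambda>k. B (beta N mu k))"
      by simp
  qed
  also have "\<dots> = (\<Sum>mu\<in>box_partitions N M.
      fdet N (\<lambda>i k. A i (beta N mu k)) * fdet N (\<lambda>k. B (beta N mu k)))"
    unfolding fdet_leibniz[of N "\<lambda>i k. A i (beta N _ k)"] by (simp only: sum_distrib_right)
  finally show ?thesis .
qed

section \<open>Schur polynomials\<close>

lemma lookup_Const_mult: "Poly_Mapping.lookup (Const a * P) m = a * Poly_Mapping.lookup P m"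
  unfolding Const_def mult_map_scale_conv_mult[symmetric] by (simp add: map.rep_eq when_def)

lemma comm_ring_hom_Const: "comm_ring_hom Const"
  by unfold_locales (simp_all add: Const_def single_add mult_single)

lemma inj_Const: "Const a = Const b \<Longrightarrow> a = b"
  by (metis Const_def lookup_single_eq)

lemma poly_mapping_sum_singles:
  "(\<Sum>m\<in>Poly_Mapping.keys P. Poly_Mapping.single m (Poly_Mapping.lookup P m)) = P"
  by (rule poly_mapping_eqI)
     (auto simp: lookup_sum lookup_single when_def in_keys_iff)

section \<open>Substitutions acting on monomials\<close>

definition monomial_hom :: "(monom \<Rightarrow> monom) \<Rightarrow> (monom \<Rightarrow> complex) \<Rightarrow> mpol \<Rightarrow> mpol" where
  "monomial_hom g h P =
     (\<Sum>m\<in>Poly_Mapping.keys P. Poly_Mapping.single (g m) (h m * Poly_Mapping.lookup P m))"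

lemma monomial_hom_superset:
  assumes "finite A" "Poly_Mapping.keys P \<subseteq> A"
  shows "monomial_hom g h P = (\<Sum>m\<in>A. Poly_Mapping.single (g m) (h m * Poly_Mapping.lookup P m))"
  unfolding monomial_hom_def
  by (rule sum.mono_neutral_left) (use assms in \<open>auto simp: in_keys_iff\<close>)

lemma monomial_hom_add: "monomial_hom g h (P + Q) = monomial_hom g h P + monomial_hom g h Q"
proof -
  let ?A = "Poly_Mapping.keys P \<union> Poly_Mapping.keys Q"
  have "Poly_Mapping.keys (P + Q) \<subseteq> ?A" by (rule keys_add)
  thus ?thesis
    by (simp add: monomial_hom_superset[of ?A] lookup_add distrib_left single_add sum.distrib)
qed

lemma monomial_hom_0 [simp]: "monomial_hom g h 0 = 0"
  by (simp add: monomial_hom_def)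

lemma monomial_hom_sum: "monomial_hom g h (sum F A) = (\<Sum>x\<in>A. monomial_hom g h (F x))"
  by (induction A rule: infinite_finite_induct) (simp_all add: monomial_hom_add)

lemma monomial_hom_single:
  "monomial_hom g h (Poly_Mapping.single m a) = Poly_Mapping.single (g m) (h m * a)"
  by (subst monomial_hom_superset[of "{m}"]) auto

text \<open>A monoid homomorphism on monomials, weighted by a multiplicative character, extends
  linearly to a ring homomorphism. Truncation, dilation and permutation of variables are the three
  instances.\<close>

lemma comm_ring_hom_monomial_hom:
  assumes "g 0 = 0" "\<And>m n. g (m + n) = g m + g n" "h 0 = 1" "\<And>m n. h (m + n) = h m * h n"
  shows "comm_ring_hom (monomial_hom g h)"
proof
  fix P Q
  let ?s = "\<lambda>P m. Poly_Mapping.single m (Poly_Mapping.lookup P m)"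
  let ?K = Poly_Mapping.keys
  have "monomial_hom g h (P * Q) = monomial_hom g h ((\<Sum>m\<in>?K P. ?s P m) * (\<Sum>n\<in>?K Q. ?s Q n))"
    by (simp only: poly_mapping_sum_singles)
  also have "\<dots> = (\<Sum>m\<in>?K P. \<Sum>n\<in>?K Q. monomial_hom g h (?s P m * ?s Q n))"
    by (simp only: sum_product monomial_hom_sum)
  also have "\<dots> = (\<Sum>m\<in>?K P. \<Sum>n\<in>?K Q. Poly_Mapping.single (g m) (h m * Poly_Mapping.lookup P m)
      * Poly_Mapping.single (g n) (h n * Poly_Mapping.lookup Q n))"
    by (simp add: mult_single monomial_hom_single assms mult_ac)
  also have "\<dots> = monomial_hom g h P * monomial_hom g h Q"
    by (simp only: sum_product monomial_hom_def)
  finally show "monomial_hom g h (P * Q) = monomial_hom g h P * monomial_hom g h Q" .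
  have "monomial_hom g h 1 = monomial_hom g h (Poly_Mapping.single 0 1)" by simp
  also have "\<dots> = 1" by (subst monomial_hom_single) (simp add: assms)
  finally show "monomial_hom g h 1 = 1" .
qed (simp_all add: monomial_hom_add)

lemma lookup_monomial_hom:
  assumes "inj g"
  shows "Poly_Mapping.lookup (monomial_hom g h P) (g m) = h m * Poly_Mapping.lookup P m"
proof -
  have "Poly_Mapping.lookup (monomial_hom g h P) (g m) =
      (\<Sum>n\<in>Poly_Mapping.keys P. if n = m then h m * Poly_Mapping.lookup P m else 0)"
    by (auto simp: monomial_hom_def lookup_sum lookup_single when_def inj_eq[OF assms] intro!: sum.cong)
  also have "\<dots> = h m * Poly_Mapping.lookup P m" by (auto simp: in_keys_iff)
  finally show ?thesis .
qed

lemma keys_add_monom: "Poly_Mapping.keys (m + n) = Poly_Mapping.keys m \<union> Poly_Mapping.keys (n :: monom)"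
  by (auto simp: in_keys_iff lookup_add)

lemma mdeg_superset:
  assumes "finite A" "Poly_Mapping.keys m \<subseteq> A"
  shows "mdeg m = (\<Sum>i\<in>A. Poly_Mapping.lookup m i)"
  unfolding mdeg_def by (rule sum.mono_neutral_left) (use assms in \<open>auto simp: in_keys_iff\<close>)

lemma mdeg_add: "mdeg (m + n) = mdeg m + mdeg n"
proof -
  let ?A = "Poly_Mapping.keys m \<union> Poly_Mapping.keys n"
  show ?thesis
    by (simp add: mdeg_superset[of ?A] keys_add_monom lookup_add sum.distrib)
qed

lemma mdeg_single_1 [simp]: "mdeg (Poly_Mapping.single i (Suc 0)) = 1"
  by (simp add: mdeg_def)

lemma mdeg_0 [simp]: "mdeg 0 = 0"
  by (simp add: mdeg_def)

definition truncate_vars :: "nat \<Rightarrow> mpol \<Rightarrow> mpol" where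
  "truncate_vars N = monomial_hom (\<lambda>m. m) (\<lambda>m. if Poly_Mapping.keys m \<subseteq> {..<N} then 1 else 0)"

text \<open>The 0/1 weight is multiplicative because natural exponents cannot cancel: a product
  involves exactly the variables of its factors.\<close>

lemma comm_ring_hom_truncate_vars: "comm_ring_hom (truncate_vars N)"
  unfolding truncate_vars_def by (rule comm_ring_hom_monomial_hom) (auto simp: keys_add_monom)

lemma truncate_vars_Var: "truncate_vars N (Var i) = (if i < N then Var i else 0)"
  by (simp add: truncate_vars_def Var_def monomial_hom_single)

lemma lookup_truncate_vars:
  "Poly_Mapping.lookup (truncate_vars N P) m =
     (if Poly_Mapping.keys m \<subseteq> {..<N} then Poly_Mapping.lookup P m else 0)"
  using lookup_monomial_hom[of "\<lambda>m. m" _ P m] by (simp add: truncate_vars_def)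

definition dilate :: "complex \<Rightarrow> mpol \<Rightarrow> mpol" where
  "dilate t = monomial_hom (\<lambda>m. m) (\<lambda>m. t ^ mdeg m)"

lemma comm_ring_hom_dilate: "comm_ring_hom (dilate t)"
  unfolding dilate_def by (rule comm_ring_hom_monomial_hom) (auto simp: mdeg_add power_add)

lemma dilate_Var: "dilate t (Var i) = Const t * Var i"
  by (simp add: dilate_def Var_def Const_def monomial_hom_single mult_single)

lemma lookup_dilate: "Poly_Mapping.lookup (dilate t P) m = t ^ mdeg m * Poly_Mapping.lookup P m"
  using lookup_monomial_hom[of "\<lambda>m. m" _ P m] by (simp add: dilate_def)

text \<open>\<open>map_key\<close> pulls exponents back, so the variable with index
  \<open>\<pi> i\<close> is sent to the one with index \<open>i\<close>; hence the inverse
  permutation in the effect on alternants.\<close>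

definition permute_vars :: "(nat \<Rightarrow> nat) \<Rightarrow> mpol \<Rightarrow> mpol" where
  "permute_vars \<pi> = monomial_hom (Poly_Mapping.map_key \<pi>) (\<lambda>_. 1)"

lemma comm_ring_hom_permute_vars:
  assumes "bij \<pi>"
  shows "comm_ring_hom (permute_vars \<pi>)"
  unfolding permute_vars_def
  by (rule comm_ring_hom_monomial_hom) (use bij_is_inj[OF assms] in \<open>auto simp: map_key_plus\<close>)

lemma permute_vars_Var:
  assumes "bij \<pi>"
  shows "permute_vars \<pi> (Var (\<pi> i)) = Var i"
  by (simp add: permute_vars_def Var_def monomial_hom_single map_key_single bij_is_inj[OF assms])

lemma lookup_map_key:
  "inj f \<Longrightarrow> Poly_Mapping.lookup (Poly_Mapping.map_key f m) i = Poly_Mapping.lookup m (f i)"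
  by (simp add: map_key.rep_eq)

lemma inj_map_key:
  assumes "bij \<pi>"
  shows "inj (Poly_Mapping.map_key \<pi> :: monom \<Rightarrow> monom)"
proof (rule injI, rule poly_mapping_eqI)
  fix m n :: monom and i
  assume "Poly_Mapping.map_key \<pi> m = Poly_Mapping.map_key \<pi> n"
  hence "Poly_Mapping.lookup (Poly_Mapping.map_key \<pi> m) (Hilbert_Choice.inv \<pi> i) =
      Poly_Mapping.lookup (Poly_Mapping.map_key \<pi> n) (Hilbert_Choice.inv \<pi> i)" by simp
  thus "Poly_Mapping.lookup m i = Poly_Mapping.lookup n i"
    by (simp add: lookup_map_key bij_is_inj[OF assms] surj_f_inv_f[OF bij_is_surj[OF assms]])
qed

lemma lookup_permute_vars:
  assumes "bij \<pi>"
  shows "Poly_Mapping.lookup (permute_vars \<pi> P) (Poly_Mapping.map_key \<pi> m) = Poly_Mapping.lookup P m"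
  using lookup_monomial_hom[OF inj_map_key[OF assms], of "\<lambda>_. 1" P m] by (simp add: permute_vars_def)

lemma fdet_mult:
  "fdet n (\<lambda>i j. \<Sum>k<n. A i k * B k j) = fdet n A * fdet n B"
proof -
  have "Matrix.mat n n (\<lambda>(i, j). \<Sum>k<n. A i k * B k j) =
      Matrix.mat n n (\<lambda>(i, j). A i j) * Matrix.mat n n (\<lambda>(i, j). B i j)"
    by (intro eq_matI) (auto simp: scalar_prod_def lessThan_atLeast0)
  thus ?thesis by (simp add: det_mult[of _ n])
qed

lemma fdet_lower_triangular:
  assumes "\<And>i j. i < j \<Longrightarrow> j < n \<Longrightarrow> f i j = 0"
  shows "fdet n f = (\<Prod>i<n. f i i)"
  using assms
proof (induction n)
  case (Suc n)
  have "fdet (Suc n) f = f n n * fdet n f" by (rule fdet_Suc_column) (use Suc in auto)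
  thus ?case using Suc by (simp add: mult.commute)
qed simp

text \<open>\<open>newton_coeff N n k\<close> is the divided difference of \<open>x\<^sup>n\<close> at \<open>x\<^sub>k, \<dots>, x\<^sub>N\<^sub>-\<^sub>1\<close>, i.e. the complete homogeneous
  polynomial of degree \<open>n - (N - 1 - k)\<close> in these variables.\<close>

primrec newton_coeff :: "nat \<Rightarrow> nat \<Rightarrow> nat \<Rightarrow> mpol" where
  "newton_coeff N 0 k = (if Suc k = N then 1 else 0)"
| "newton_coeff N (Suc n) k = Var k * newton_coeff N n k + newton_coeff N n (Suc k)"

lemma newton_coeff_ge: "N \<le> k \<Longrightarrow> newton_coeff N n k = 0"
  by (induction n arbitrary: k) auto

lemma newton_coeff_small: "n + Suc k < N \<Longrightarrow> newton_coeff N n k = 0"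
  by (induction n arbitrary: k) auto

lemma newton_coeff_eq_1: "n + Suc k = N \<Longrightarrow> newton_coeff N n k = 1"
  by (induction n arbitrary: k) (auto simp: newton_coeff_small)

text \<open>Newton interpolation of x^n with the nodes taken from the last variable back to the
  first, evaluated at a node.\<close>

lemma Var_power_newton:
  assumes "j < N"
  shows "Var j ^ n = (\<Sum>k<N. newton_coeff N n k * (\<Prod>l=Suc k..<N. Var j - Var l))"
proof -
  define T where "T k = (\<Prod>l=k..<N. Var j - Var l)" for k
  \<comment> \<open>The Newton remainder carries the product over all nodes, which vanishes at the
    node \<open>Var j\<close>.\<close>
  have T0: "T 0 = 0" unfolding T_def using assms by (intro prod_zero) auto
  have step: "Var j * T (Suc k) = Var k * T (Suc k) + T k" if "k < N" for k
  proof -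
    have "{k..<N} = insert k {Suc k..<N}" using that by auto
    hence "T k = (Var j - Var k) * T (Suc k)" by (simp add: T_def)
    thus ?thesis by (simp add: algebra_simps)
  qed
  have "Var j ^ n = (\<Sum>k<N. newton_coeff N n k * T (Suc k))"
  proof (induction n)
    case 0
    have "(\<Sum>k<N. newton_coeff N 0 k * T (Suc k)) = (\<Sum>k<N. if k = N - 1 then T N else 0)"
      using assms by (intro sum.cong) auto
    also have "\<dots> = 1" using assms by (simp add: T_def)
    finally show ?case by simp
  next
    case (Suc n)
    let ?c = "newton_coeff N n"
    have "(\<Sum>k<N. ?c k * T k) = (\<Sum>k<Suc N. ?c k * T k)" by (simp add: newton_coeff_ge)
    also have "\<dots> = (\<Sum>k<N. ?c (Suc k) * T (Suc k))"
      by (subst sum.lessThan_Suc_shift) (simp add: T0)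
    finally have shift: "(\<Sum>k<N. ?c k * T k) = (\<Sum>k<N. ?c (Suc k) * T (Suc k))" .
    have "Var j ^ Suc n = (\<Sum>k<N. ?c k * (Var j * T (Suc k)))"
      by (simp add: Suc sum_distrib_left mult_ac)
    also have "\<dots> = (\<Sum>k<N. ?c k * (Var k * T (Suc k)) + ?c k * T k)"
      by (intro sum.cong refl) (simp add: step distrib_left)
    also have "\<dots> = (\<Sum>k<N. ?c k * (Var k * T (Suc k))) + (\<Sum>k<N. ?c (Suc k) * T (Suc k))"
      by (simp only: sum.distrib shift)
    also have "\<dots> = (\<Sum>k<N. newton_coeff N (Suc n) k * T (Suc k))"
      by (simp add: sum.distrib[symmetric] algebra_simps)
    finally show ?case .
  qed
  thus ?thesis by (simp add: T_def)
qed

text \<open>A Jacobi-Trudi determinant in shrinking sets of variables: entry (i, k) is the complete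
  homogeneous polynomial of degree mu_i - i + k in x_k, ..., x_(N-1). It exhibits the quotient of
  alternants as a polynomial outright.\<close>

definition schur_poly :: "(nat \<Rightarrow> nat) \<Rightarrow> nat \<Rightarrow> mpol" where
  "schur_poly mu N = fdet N (\<lambda>i. newton_coeff N (beta N mu i))"

definition power_alternant :: "(nat \<Rightarrow> nat) \<Rightarrow> nat \<Rightarrow> mpol" where
  "power_alternant mu N = fdet N (\<lambda>i j. Var j ^ beta N mu i)"

lemma vandermonde_altdef: "vandermonde N = (\<Prod>k<N. \<Prod>l=Suc k..<N. Var k - Var l)"
proof -
  have "{(i, j). i < j \<and> j < N} = Sigma {..<N} (\<lambda>k. {Suc k..<N})" by auto
  thus ?thesis by (simp add: vandermonde_def prod.Sigma)
qed

text \<open>Newton interpolation factors the matrix of powers. The second factor is lower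
  triangular, and its diagonal multiplies to the Vandermonde product.\<close>

lemma schur_poly_mult_vandermonde: "schur_poly mu N * vandermonde N = power_alternant mu N"
proof -
  let ?M = "\<lambda>k j. \<Prod>l=Suc k..<N. Var j - Var l"
  have "fdet N ?M = vandermonde N"
    unfolding vandermonde_altdef
    by (rule fdet_lower_triangular) (auto intro!: prod_zero)
  hence "schur_poly mu N * vandermonde N =
      fdet N (\<lambda>i j. \<Sum>k<N. newton_coeff N (beta N mu i) k * ?M k j)"
    unfolding fdet_mult schur_poly_def by simp
  also have "\<dots> = power_alternant mu N"
    unfolding power_alternant_def by (rule fdet_cong) (simp add: Var_power_newton)
  finally show ?thesis .
qed

lemma power_alternant_zero: "power_alternant (\<lambda>_. 0) N = vandermonde N"
proof -
  have "schur_poly (\<lambda>_. 0) N = 1"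
    unfolding schur_poly_def
    by (rule fdet_upper_unitriangular)
       (auto simp: beta_def intro!: newton_coeff_small newton_coeff_eq_1)
  thus ?thesis using schur_poly_mult_vandermonde[of "\<lambda>_. 0" N] by simp
qed

lemma Var_inject: "Var i = Var j \<longleftrightarrow> i = j"
proof
  assume "Var i = Var j"
  hence "Poly_Mapping.keys (Var i) = Poly_Mapping.keys (Var j)" by simp
  hence "Poly_Mapping.keys (Poly_Mapping.single i (1::nat)) = Poly_Mapping.keys (Poly_Mapping.single j (1::nat))"
    by (simp add: Var_def)
  thus "i = j" by simp
qed simp

lemma Var_nonzero: "Var i \<noteq> 0"
proof
  assume "Var i = 0"
  hence "Poly_Mapping.keys (Var i) = {}" by simp
  thus False by (simp add: Var_def)
qed

lemma vandermonde_nonzero: "vandermonde N \<noteq> 0"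
  by (auto simp: vandermonde_altdef Var_inject)

text \<open>The homomorphisms used below multiply every alternant by a factor, so their effect on
  Schur polynomials is read off after cancelling the Vandermonde product, which is itself the
  alternant of the empty partition.\<close>

lemma hom_schur_poly:
  assumes h: "comm_ring_hom h"
    and mu: "h (power_alternant mu N) = u * power_alternant mu N'"
    and zero: "h (power_alternant (\<lambda>_. 0) N) = v * power_alternant (\<lambda>_. 0) N'" and "v \<noteq> 0"
    and uv: "u = w * v"
  shows "h (schur_poly mu N) = w * schur_poly mu N'"
proof -
  interpret comm_ring_hom h by (rule h)
  have "h (schur_poly mu N) * (v * vandermonde N') = h (schur_poly mu N * vandermonde N)"
    using zero by (simp add: hom_mult power_alternant_zero)
  also have "\<dots> = w * v * (schur_poly mu N' * vandermonde N')"
    using mu uv by (simp add: schur_poly_mult_vandermonde)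
  finally have "h (schur_poly mu N) * (v * vandermonde N') = (w * schur_poly mu N') * (v * vandermonde N')"
    by (simp add: mult_ac)
  thus ?thesis using \<open>v \<noteq> 0\<close> vandermonde_nonzero by simp
qed

lemma hom_power_alternant:
  assumes "comm_ring_hom h"
  shows "h (power_alternant mu N) = fdet N (\<lambda>i j. h (Var j) ^ beta N mu i)"
proof -
  interpret comm_ring_hom h by (rule assms)
  show ?thesis by (simp add: power_alternant_def hom_fdet[OF assms] hom_power)
qed

section \<open>Stability, symmetry and homogeneity of Schur polynomials\<close>

lemma truncate_schur_poly: "truncate_vars N (schur_poly mu N) = schur_poly mu N"
proof -
  have "truncate_vars N (power_alternant nu N) = 1 * power_alternant nu N" for nu
    unfolding hom_power_alternant[OF comm_ring_hom_truncate_vars] mult_1 unfolding power_alternant_def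
    by (rule fdet_cong) (simp add: truncate_vars_Var)
  from hom_schur_poly[OF comm_ring_hom_truncate_vars this this, of 1] show ?thesis by simp
qed

text \<open>Setting x_N to 0 clears the last column except for its corner, and each remaining column
  then carries a spare factor x_j. The alternants of mu and of the empty partition acquire the same
  factor.\<close>

lemma truncate_schur_poly_Suc:
  assumes "mu N = 0"
  shows "truncate_vars N (schur_poly mu (Suc N)) = schur_poly mu N"
proof -
  have *: "truncate_vars N (power_alternant nu (Suc N)) = (\<Prod>j<N. Var j) * power_alternant nu N"
    if "nu N = 0" for nu
  proof -
    let ?f = "\<lambda>i j. truncate_vars N (Var j) ^ beta (Suc N) nu i"
    have "truncate_vars N (power_alternant nu (Suc N)) = fdet (Suc N) ?f"
      by (rule hom_power_alternant[OF comm_ring_hom_truncate_vars])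
    also have "\<dots> = ?f N N * fdet N ?f"
      by (rule fdet_Suc_column) (simp add: truncate_vars_Var beta_def)
    \<comment> \<open>The exponent here is \<open>nu N\<close>, which is 0, so the corner is
      \<open>0 ^ 0\<close>.\<close>
    also have "?f N N = 1" using that by (simp add: beta_def)
    also have "fdet N ?f = fdet N (\<lambda>i j. 1 * Var j ^ beta N nu i * Var j)"
    proof (rule fdet_cong)
      fix i j assume "i < N" "j < N"
      moreover from this have "beta (Suc N) nu i = Suc (beta N nu i)" by (simp add: beta_def)
      ultimately show "?f i j = 1 * Var j ^ beta N nu i * Var j"
        by (simp add: truncate_vars_Var mult.commute)
    qed
    also have "\<dots> = (\<Prod>j<N. Var j) * power_alternant nu N"
      unfolding fdet_scale_rows_columns by (simp add: power_alternant_def)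
    finally show ?thesis by simp
  qed
  have "(\<Prod>j<N. Var j) \<noteq> 0" by (simp add: Var_nonzero)
  from hom_schur_poly[OF comm_ring_hom_truncate_vars *[of mu, OF assms] *[of "\<lambda>_. 0", OF refl] this, of 1]
  show ?thesis by simp
qed

text \<open>Numerator and Vandermonde product both have their columns permuted, and the two signs
  agree.\<close>

lemma permute_schur_poly:
  assumes "\<pi> permutes {..<N}"
  shows "permute_vars \<pi> (schur_poly mu N) = schur_poly mu N"
proof -
  have bij: "bij \<pi>" by (rule permutes_bij[OF assms])
  have inv: "Hilbert_Choice.inv \<pi> permutes {0..<N}" using permutes_inv[OF assms] by (simp add: lessThan_atLeast0)
  have *: "permute_vars \<pi> (power_alternant nu N) = signof (Hilbert_Choice.inv \<pi>) * power_alternant nu N" for nu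
  proof -
    have "permute_vars \<pi> (power_alternant nu N) = fdet N (\<lambda>i j. Var (Hilbert_Choice.inv \<pi> j) ^ beta N nu i)"
      unfolding hom_power_alternant[OF comm_ring_hom_permute_vars[OF bij]]
    proof (rule fdet_cong)
      fix i j
      show "permute_vars \<pi> (Var j) ^ beta N nu i = Var (Hilbert_Choice.inv \<pi> j) ^ beta N nu i"
        using permute_vars_Var[OF bij, of "Hilbert_Choice.inv \<pi> j"] surj_f_inv_f[OF bij_is_surj[OF bij]] by simp
    qed
    also have "\<dots> = signof (Hilbert_Choice.inv \<pi>) * power_alternant nu N"
      unfolding power_alternant_def by (rule fdet_permute_columns[OF inv])
    finally show ?thesis .
  qed
  have "signof (Hilbert_Choice.inv \<pi>) \<noteq> (0 :: mpol)" by (simp add: sign_def)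
  from hom_schur_poly[OF comm_ring_hom_permute_vars[OF bij] * * this, of 1] show ?thesis by simp
qed

lemma dilate_schur_poly: "dilate t (schur_poly mu N) = Const (t ^ (\<Sum>i<N. mu i)) * schur_poly mu N"
  if "t \<noteq> 0"
proof -
  interpret Const: comm_ring_hom Const by (rule comm_ring_hom_Const)
  let ?c = "\<lambda>nu. \<Prod>i<N. Const t ^ beta N nu i"
  have *: "dilate t (power_alternant nu N) = ?c nu * power_alternant nu N" for nu
  proof -
    have "dilate t (power_alternant nu N) = fdet N (\<lambda>i j. Const t ^ beta N nu i * Var j ^ beta N nu i * 1)"
      unfolding hom_power_alternant[OF comm_ring_hom_dilate]
      by (simp add: dilate_Var power_mult_distrib)
    thus ?thesis unfolding fdet_scale_rows_columns by (simp add: power_alternant_def)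
  qed
  have nz: "?c (\<lambda>_. 0) \<noteq> 0"
    using that inj_Const[of t 0] by (auto simp: Const.hom_zero)
  have "beta N mu i = mu i + beta N (\<lambda>_. 0) i" if "i < N" for i
    using that by (simp add: beta_def)
  hence "?c mu = (\<Prod>i<N. Const t ^ mu i) * ?c (\<lambda>_. 0)"
    by (simp add: power_add prod.distrib)
  also have "(\<Prod>i<N. Const t ^ mu i) = Const (t ^ (\<Sum>i<N. mu i))"
    by (simp add: Const.hom_power Const.hom_prod power_sum)
  finally show ?thesis
    by (rule hom_schur_poly[OF comm_ring_hom_dilate * * nz])
qed

text \<open>Dilating by the single value 2 suffices, since a power of 2 determines its
  exponent.\<close>

lemma schur_poly_homogeneous:
  assumes "Poly_Mapping.lookup (schur_poly mu N) m \<noteq> 0"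
  shows "mdeg m = (\<Sum>i<N. mu i)"
proof -
  have "(2::complex) ^ mdeg m * Poly_Mapping.lookup (schur_poly mu N) m =
      2 ^ (\<Sum>i<N. mu i) * Poly_Mapping.lookup (schur_poly mu N) m"
    using arg_cong[OF dilate_schur_poly[of 2 mu N], of "\<lambda>P. Poly_Mapping.lookup P m"]
    by (simp add: lookup_dilate lookup_Const_mult)
  hence "(2::complex) ^ mdeg m = 2 ^ (\<Sum>i<N. mu i)" using assms by simp
  hence "(2::real) ^ mdeg m = 2 ^ (\<Sum>i<N. mu i)"
    by (metis norm_numeral norm_power)
  thus ?thesis by simp
qed

lemma keys_schur_poly:
  assumes "Poly_Mapping.lookup (schur_poly mu N) m \<noteq> 0"
  shows "Poly_Mapping.keys m \<subseteq> {..<N}"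
  using assms truncate_schur_poly[of N mu] by (metis lookup_truncate_vars)

lemma schur_poly_symmetric:
  assumes "\<pi> permutes {..<N}"
  shows "Poly_Mapping.lookup (schur_poly mu N) (Poly_Mapping.map_key \<pi> m) =
    Poly_Mapping.lookup (schur_poly mu N) m"
  using lookup_permute_vars[OF permutes_bij[OF assms]] permute_schur_poly[OF assms] by metis

lemma schur_poly_stable:
  assumes "\<forall>i\<ge>N. mu i = 0" "N \<le> N'" "Poly_Mapping.keys m \<subseteq> {..<N}"
  shows "Poly_Mapping.lookup (schur_poly mu N') m = Poly_Mapping.lookup (schur_poly mu N) m"
  using assms(2)
proof (induction N' rule: dec_induct)
  case (step n)
  have "Poly_Mapping.keys m \<subseteq> {..<n}" using assms(3) step by force
  hence "Poly_Mapping.lookup (schur_poly mu (Suc n)) m =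
      Poly_Mapping.lookup (truncate_vars n (schur_poly mu (Suc n))) m"
    by (simp add: lookup_truncate_vars)
  thus ?case using step assms(1) by (simp add: truncate_schur_poly_Suc)
qed simp

section \<open>Convergence of Schur expansions\<close>

text \<open>\<open>plength\<close> only counts nonzero parts; monotonicity makes them an initial
  segment.\<close>

lemma partition_nonzero_iff:
  assumes "is_partition mu"
  shows "mu i \<noteq> 0 \<longleftrightarrow> i < plength mu"
proof
  have anti: "antimono mu" and fin: "finite {i. mu i \<noteq> 0}"
    using assms by (auto simp: is_partition_def)
  show "i < plength mu" if "mu i \<noteq> 0"
  proof -
    have "{..i} \<subseteq> {i. mu i \<noteq> 0}" using antimonoD[OF anti] that by fastforce
    from card_mono[OF fin this] show ?thesis by (simp add: plength_def)
  qed
  show "mu i \<noteq> 0" if "i < plength mu"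
  proof
    assume *: "mu i = 0"
    have "j < i" if "mu j \<noteq> 0" for j
      using antimonoD[OF anti, of i j] that * by (cases "i \<le> j") auto
    hence "{i. mu i \<noteq> 0} \<subseteq> {..<i}" by auto
    from card_mono[OF _ this] show False using \<open>i < plength mu\<close> by (simp add: plength_def)
  qed
qed

lemma partition_eq_0: "is_partition mu \<Longrightarrow> plength mu \<le> i \<Longrightarrow> mu i = 0"
  using partition_nonzero_iff[of mu i] by auto

lemma plength_mono:
  assumes "is_partition mu" "is_partition lam" "mu \<le> lam"
  shows "plength mu \<le> plength lam"
proof (rule ccontr)
  assume "\<not> ?thesis"
  hence "mu (plength lam) \<noteq> 0" using partition_nonzero_iff[OF assms(1)] by simp
  moreover have "lam (plength lam) = 0" by (rule partition_eq_0[OF assms(2)]) simp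
  ultimately show False using le_funD[OF assms(3), of "plength lam"] by simp
qed

lemma sum_partition_superset:
  assumes "is_partition mu" "plength mu \<le> N" "\<And>i. g i 0 = 0"
  shows "(\<Sum>i<plength mu. g i (mu i)) = (\<Sum>i<N. g i (mu i))"
  by (rule sum.mono_neutral_left) (use assms partition_eq_0[OF assms(1)] in auto)

lemma psize_superset:
  assumes "is_partition mu" "plength mu \<le> N"
  shows "psize mu = (\<Sum>i<N. mu i)"
  unfolding psize_def by (rule sum_partition_superset[OF assms, of "\<lambda>_ x. x"]) simp

section \<open>Schur functions in infinitely many variables\<close>

definition monom_bound :: "monom \<Rightarrow> nat" where
  "monom_bound m = (\<Sum>i\<in>Poly_Mapping.keys m. Suc i)"

lemma keys_monom_bound: "Poly_Mapping.keys m \<subseteq> {..<monom_bound m}"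
proof
  fix i assume "i \<in> Poly_Mapping.keys m"
  hence "Suc i \<le> monom_bound m" unfolding monom_bound_def by (intro member_le_sum) auto
  thus "i \<in> {..<monom_bound m}" by simp
qed

text \<open>By stability a coefficient no longer changes once there are enough variables for both mu
  and m, so the limit is read off at one such number.\<close>

definition schur_fun :: "(nat \<Rightarrow> nat) \<Rightarrow> symfun" where
  "schur_fun mu m = Poly_Mapping.lookup (schur_poly mu (max (plength mu) (monom_bound m))) m"

lemma schur_fun_eq:
  assumes mu: "is_partition mu" and N: "plength mu \<le> N" "Poly_Mapping.keys m \<subseteq> {..<N}"
  shows "schur_fun mu m = Poly_Mapping.lookup (schur_poly mu N) m"
proof -
  have zero: "\<forall>i\<ge>N. mu i = 0" if "plength mu \<le> N" for N
    using partition_eq_0[OF mu] that by auto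
  let ?M = "max (plength mu) (monom_bound m)"
  have "Poly_Mapping.keys m \<subseteq> {..<?M}" using keys_monom_bound[of m] by force
  hence "schur_fun mu m = Poly_Mapping.lookup (schur_poly mu (max N ?M)) m"
    unfolding schur_fun_def by (intro schur_poly_stable[symmetric] zero) auto
  also have "\<dots> = Poly_Mapping.lookup (schur_poly mu N) m"
    by (intro schur_poly_stable zero) (use N in auto)
  finally show ?thesis .
qed

lemma schur_fun_homogeneous:
  assumes "is_partition mu" "schur_fun mu m \<noteq> 0"
  shows "mdeg m = psize mu"
  using schur_poly_homogeneous[OF assms(2)[unfolded schur_fun_def]]
    psize_superset[OF assms(1), of "max (plength mu) (monom_bound m)"] by simp

text \<open>The complements of A and B in \<open>{..<K}\<close> have equal size and can be matched
  arbitrarily. This links the arbitrary bijections in \<open>Sym_upto\<close> with the finite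
  permutations under which Schur polynomials are symmetric.\<close>

lemma extend_to_permutation:
  assumes "bij_betw f A B" "A \<subseteq> {..<K::nat}" "B \<subseteq> {..<K}"
  obtains \<pi> where "\<pi> permutes {..<K}" "\<And>a. a \<in> A \<Longrightarrow> \<pi> a = f a"
proof -
  have fin: "finite A" "finite B" using assms by (auto intro: finite_subset)
  have "card ({..<K} - A) = card ({..<K} - B)"
    using assms fin by (simp add: card_Diff_subset bij_betw_same_card)
  then obtain h where h: "bij_betw h ({..<K} - A) ({..<K} - B)"
    using finite_same_card_bij[of "{..<K} - A" "{..<K} - B"] by auto
  define \<pi> where "\<pi> i = (if i \<in> A then f i else if i < K then h i else i)" for i
  have "bij_betw \<pi> A B" by (rule iffD2[OF bij_betw_cong assms(1)]) (simp add: \<pi>_def)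
  moreover have "bij_betw \<pi> ({..<K} - A) ({..<K} - B)"
    by (rule iffD2[OF bij_betw_cong h]) (simp add: \<pi>_def)
  ultimately have "bij_betw \<pi> (A \<union> ({..<K} - A)) (B \<union> ({..<K} - B))"
    by (rule bij_betw_combine) auto
  hence "bij_betw \<pi> {..<K} {..<K}" using assms by (simp add: Un_absorb1)
  moreover have "\<pi> i = i" if "i \<notin> {..<K}" for i using that assms by (auto simp: \<pi>_def)
  ultimately have "\<pi> permutes {..<K}" by (rule bij_imp_permutes)
  thus ?thesis by (rule that) (simp add: \<pi>_def)
qed

lemma keys_map_key_bij:
  "bij \<pi> \<Longrightarrow> Poly_Mapping.keys (Poly_Mapping.map_key \<pi> m) = \<pi> -` Poly_Mapping.keys m"
  by (auto simp: in_keys_iff lookup_map_key bij_is_inj)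

lemma bij_betw_vimage_keys: "bij \<pi> \<Longrightarrow> bij_betw \<pi> (\<pi> -` A) A"
  by (auto simp: bij_betw_def bij_is_surj surj_image_vimage_eq intro: inj_on_subset[OF bij_is_inj])

lemma schur_fun_in_Sym:
  assumes mu: "is_partition mu"
  shows "schur_fun mu \<in> Sym_upto (psize mu)"
proof -
  have "schur_fun mu (Poly_Mapping.map_key \<pi> m) = schur_fun mu m" if \<pi>: "bij \<pi>" for \<pi> m
  proof -
    let ?m' = "Poly_Mapping.map_key \<pi> m"
    let ?A = "Poly_Mapping.keys ?m'"
    define K where "K = max (plength mu) (max (monom_bound m) (monom_bound ?m'))"
    have K: "plength mu \<le> K" "Poly_Mapping.keys m \<subseteq> {..<K}" "?A \<subseteq> {..<K}"
      using keys_monom_bound[of m] keys_monom_bound[of ?m'] by (force simp: K_def)+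
    have bij: "bij_betw \<pi> ?A (Poly_Mapping.keys m)"
      unfolding keys_map_key_bij[OF \<pi>] by (rule bij_betw_vimage_keys[OF \<pi>])
    obtain \<rho> where \<rho>: "\<rho> permutes {..<K}" "\<And>a. a \<in> ?A \<Longrightarrow> \<rho> a = \<pi> a"
      using extend_to_permutation[OF bij K(3,2)] by blast
    have inj: "inj \<rho>" by (rule permutes_inj[OF \<rho>(1)])
    \<comment> \<open>On the support of \<open>?m'\<close> the two bijections agree; elsewhere both
      pull back exponent 0, since \<rho> already fills the support of m from
      \<open>?A\<close>.\<close>
    have "Poly_Mapping.map_key \<rho> m = ?m'"
    proof (rule poly_mapping_eqI)
      fix i
      show "Poly_Mapping.lookup (Poly_Mapping.map_key \<rho> m) i = Poly_Mapping.lookup ?m' i"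
      proof (cases "i \<in> ?A")
        case True
        thus ?thesis using \<rho>(2) by (simp add: lookup_map_key inj bij_is_inj[OF \<pi>])
      next
        case False
        have "\<rho> i \<notin> Poly_Mapping.keys m"
        proof
          assume "\<rho> i \<in> Poly_Mapping.keys m"
          then obtain j where "j \<in> ?A" "\<rho> i = \<pi> j" using bij by (auto simp: bij_betw_def)
          hence "\<rho> i = \<rho> j" using \<rho>(2) by simp
          thus False using False inj \<open>j \<in> ?A\<close> by (auto dest: injD)
        qed
        thus ?thesis using False by (simp add: lookup_map_key inj in_keys_iff)
      qed
    qed
    hence "Poly_Mapping.lookup (schur_poly mu K) ?m' = Poly_Mapping.lookup (schur_poly mu K) m"
      using schur_poly_symmetric[OF \<rho>(1)] by metis
    thus ?thesis using K schur_fun_eq[OF mu] by simp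
  qed
  thus ?thesis using schur_fun_homogeneous[OF mu] by (auto simp: Sym_upto_def)
qed

lemma Sym_upto_mono: "d \<le> e \<Longrightarrow> Sym_upto d \<subseteq> Sym_upto e"
  by (fastforce simp: Sym_upto_def)

lemma Sym_upto_sum:
  assumes "\<And>t. t \<in> T \<Longrightarrow> F t \<in> Sym_upto d"
  shows "(\<lambda>m. \<Sum>t\<in>T. a t * F t m) \<in> Sym_upto d"
proof -
  have "mdeg m \<le> d" if "(\<Sum>t\<in>T. a t * F t m) \<noteq> 0" for m
  proof -
    from that obtain t where "t \<in> T" "a t * F t m \<noteq> 0" by (meson sum.neutral)
    thus ?thesis using assms by (auto simp: Sym_upto_def)
  qed
  moreover have "(\<Sum>t\<in>T. a t * F t (Poly_Mapping.map_key \<pi> m)) = (\<Sum>t\<in>T. a t * F t m)"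
    if "bij \<pi>" for \<pi> m
    using assms that by (intro sum.cong refl) (auto simp: Sym_upto_def)
  ultimately show ?thesis by (simp add: Sym_upto_def)
qed

lemma Symp_upto_sum:
  assumes "\<And>t. t \<in> T \<Longrightarrow> P t \<in> Symp_upto d N"
  shows "(\<Sum>t\<in>T. Const (a t) * P t) \<in> Symp_upto d N"
proof -
  have "Poly_Mapping.keys m \<subseteq> {..<N} \<and> mdeg m \<le> d"
    if "(\<Sum>t\<in>T. a t * Poly_Mapping.lookup (P t) m) \<noteq> 0" for m
  proof -
    from that obtain t where "t \<in> T" "a t * Poly_Mapping.lookup (P t) m \<noteq> 0" by (meson sum.neutral)
    hence "m \<in> Poly_Mapping.keys (P t)" by (simp add: in_keys_iff)
    thus ?thesis using assms[OF \<open>t \<in> T\<close>] unfolding Symp_upto_def by blast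
  qed
  moreover have "(\<Sum>t\<in>T. a t * Poly_Mapping.lookup (P t) (Poly_Mapping.map_key \<pi> m)) =
      (\<Sum>t\<in>T. a t * Poly_Mapping.lookup (P t) m)"
    if "\<pi> permutes {..<N}" for \<pi> m
    using assms that by (intro sum.cong refl) (auto simp: Symp_upto_def)
  ultimately show ?thesis
    by (simp add: Symp_upto_def in_keys_iff lookup_sum lookup_Const_mult)
qed

lemma schur_poly_in_Symp:
  assumes "is_partition mu" "plength mu \<le> N" "psize mu \<le> d"
  shows "schur_poly mu N \<in> Symp_upto d N"
proof -
  have "Poly_Mapping.keys m \<subseteq> {..<N} \<and> mdeg m \<le> d"
    if "Poly_Mapping.lookup (schur_poly mu N) m \<noteq> 0" for m
    using keys_schur_poly[OF that] schur_poly_homogeneous[OF that] psize_superset[OF assms(1,2)]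
      assms(3) by simp
  thus ?thesis by (simp add: Symp_upto_def in_keys_iff schur_poly_symmetric)
qed

section \<open>Specialization to finitely many variables\<close>

lemma finite_bounded_monoms: "finite {m. Poly_Mapping.keys m \<subseteq> {..<N} \<and> mdeg m \<le> d}"
proof -
  let ?S = "{m. Poly_Mapping.keys m \<subseteq> {..<N} \<and> mdeg m \<le> d}"
  have "finite {f. \<forall>i. (i \<in> {..<N} \<longrightarrow> f i \<in> {..d}) \<and> (i \<notin> {..<N} \<longrightarrow> f i = 0)}"
    by (rule finite_set_of_finite_funs) auto
  moreover have "Poly_Mapping.lookup ` ?S \<subseteq>
      {f. \<forall>i. (i \<in> {..<N} \<longrightarrow> f i \<in> {..d}) \<and> (i \<notin> {..<N} \<longrightarrow> f i = 0)}"
  proof clarify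
    fix m :: monom and i assume m: "Poly_Mapping.keys m \<subseteq> {..<N}" "mdeg m \<le> d"
    have "Poly_Mapping.lookup m i \<le> mdeg m"
    proof (cases "i \<in> Poly_Mapping.keys m")
      case True
      thus ?thesis unfolding mdeg_def by (intro member_le_sum) auto
    qed (simp add: in_keys_iff)
    thus "(i \<in> {..<N} \<longrightarrow> Poly_Mapping.lookup m i \<in> {..d}) \<and>
        (i \<notin> {..<N} \<longrightarrow> Poly_Mapping.lookup m i = 0)"
      using m by (auto simp: in_keys_iff)
  qed
  ultimately have "finite (Poly_Mapping.lookup ` ?S)" by (rule rev_finite_subset)
  moreover have "inj_on Poly_Mapping.lookup ?S" by (auto intro!: inj_onI poly_mapping_eqI)
  ultimately show ?thesis by (rule finite_imageD)
qed

text \<open>\<open>Abs_poly_mapping\<close> returns the intended coefficients only for finite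
  support, which the degree bound provides.\<close>

lemma lookup_specialize:
  assumes "F \<in> Sym_upto d"
  shows "Poly_Mapping.lookup (specialize N F) m = (if Poly_Mapping.keys m \<subseteq> {..<N} then F m else 0)"
proof -
  have "{m. (if Poly_Mapping.keys m \<subseteq> {..<N} then F m else 0) \<noteq> 0} \<subseteq>
      {m. Poly_Mapping.keys m \<subseteq> {..<N} \<and> mdeg m \<le> d}"
    using assms by (auto simp: Sym_upto_def split: if_splits)
  hence "finite {m. (if Poly_Mapping.keys m \<subseteq> {..<N} then F m else 0) \<noteq> 0}"
    by (rule finite_subset) (rule finite_bounded_monoms)
  thus ?thesis by (simp add: specialize_def Abs_poly_mapping_inverse)
qed

lemma card_keys_le_mdeg: "card (Poly_Mapping.keys m) \<le> mdeg m"
proof -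
  have "card (Poly_Mapping.keys m) = (\<Sum>i\<in>Poly_Mapping.keys m. 1)" by simp
  also have "\<dots> \<le> mdeg m" unfolding mdeg_def by (rule sum_mono) (simp add: in_keys_iff Suc_le_eq)
  finally show ?thesis .
qed

text \<open>A monomial of degree at most d involves at most d \<le> N variables, so symmetry moves
  it into the first N, where the specialization still sees it.\<close>

lemma inj_on_specialize:
  assumes "d \<le> N"
  shows "inj_on (specialize N) (Sym_upto d)"
proof (rule inj_onI, rule ext)
  fix F G m assume F: "F \<in> Sym_upto d" and G: "G \<in> Sym_upto d" and eq: "specialize N F = specialize N G"
  show "F m = G m"
  proof (cases "mdeg m \<le> d")
    case True
    let ?k = "card (Poly_Mapping.keys m)"
    have "?k \<le> d" using card_keys_le_mdeg[of m] True by simp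
    obtain f where f: "bij_betw f {..<?k} (Poly_Mapping.keys m)"
      using finite_same_card_bij[of "{..<?k}" "Poly_Mapping.keys m"] by auto
    obtain \<pi> where \<pi>: "\<pi> permutes {..<max ?k (monom_bound m)}" "\<And>i. i \<in> {..<?k} \<Longrightarrow> \<pi> i = f i"
      by (rule extend_to_permutation[OF f, of "max ?k (monom_bound m)"])
         (use keys_monom_bound[of m] in force)+
    have bij: "bij \<pi>" by (rule permutes_bij[OF \<pi>(1)])
    have "\<pi> ` {..<?k} = f ` {..<?k}" using \<pi>(2) by (intro image_cong) auto
    hence "Poly_Mapping.keys m = \<pi> ` {..<?k}" using f by (simp add: bij_betw_def)
    hence "\<pi> -` Poly_Mapping.keys m = {..<?k}"
      by (metis inj_vimage_image_eq bij_is_inj[OF bij])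
    hence keys: "Poly_Mapping.keys (Poly_Mapping.map_key \<pi> m) \<subseteq> {..<N}"
      using \<open>?k \<le> d\<close> assms by (auto simp: keys_map_key_bij[OF bij])
    have "F m = F (Poly_Mapping.map_key \<pi> m)" using F bij by (simp add: Sym_upto_def)
    also have "\<dots> = Poly_Mapping.lookup (specialize N F) (Poly_Mapping.map_key \<pi> m)"
      using keys by (simp add: lookup_specialize[OF F])
    also have "\<dots> = G (Poly_Mapping.map_key \<pi> m)"
      using keys by (simp add: eq lookup_specialize[OF G])
    also have "\<dots> = G m" using G bij by (simp add: Sym_upto_def)
    finally show ?thesis .
  next
    case False
    thus ?thesis using F G unfolding Sym_upto_def by (metis (mono_tags, lifting) mem_Collect_eq)
  qed
qed

lemma lift_sym_specialize:
  "d \<le> N \<Longrightarrow> F \<in> Sym_upto d \<Longrightarrow> lift_sym d N (specialize N F) = F"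
  unfolding lift_sym_def by (intro inv_into_f_f inj_on_specialize)

lemma tendsto_fun_iff:
  fixes f :: "'b \<Rightarrow> 'c \<Rightarrow> 'd::topological_space"
  shows "(f \<longlongrightarrow> L) F \<longleftrightarrow> (\<forall>m. ((\<lambda>x. f x m) \<longlongrightarrow> L m) F)"
proof -
  have "(f \<longlongrightarrow> L) F \<longleftrightarrow> limitin (product_topology (\<lambda>_. euclidean) UNIV) f L F"
    by (simp only: euclidean_product_topology limitin_canonical_iff)
  thus ?thesis by (simp add: limitin_componentwise limitin_canonical_iff)
qed

lemma sym_converges_unique:
  assumes "sym_converges N0 F L" "sym_converges N0 F L'"
  shows "L = L'"
proof -
  obtain d0 where d0: "\<And>d. d \<ge> d0 \<Longrightarrow> (\<lambda>N. lift_sym d N (F N)) \<longlonglongrightarrow> L"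
    using assms(1) by (auto simp: sym_converges_def)
  obtain d0' where d0': "\<And>d. d \<ge> d0' \<Longrightarrow> (\<lambda>N. lift_sym d N (F N)) \<longlonglongrightarrow> L'"
    using assms(2) by (auto simp: sym_converges_def)
  show ?thesis
    using d0[of "max d0 d0'"] d0'[of "max d0 d0'"] by (auto simp: tendsto_fun_iff intro: LIMSEQ_unique)
qed

text \<open>\<open>F N\<close> is the specialization of the same combination of Schur functions, so
  the lift returns that combination and only the coefficients move. The family \<open>nu\<close> may
  repeat a partition; the index set in the final application consists of pairs.\<close>

lemma sym_converges_schur_expansion:
  assumes T: "finite T" "\<And>t. t \<in> T \<Longrightarrow> is_partition (nu t)" "\<And>t. t \<in> T \<Longrightarrow> plength (nu t) \<le> N0"
    and F: "\<And>N. N \<ge> N0 \<Longrightarrow> F N = (\<Sum>t\<in>T. Const (a N t) * schur_poly (nu t) N)"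
    and lim: "\<And>t. t \<in> T \<Longrightarrow> (\<lambda>N. a N t) \<longlonglongrightarrow> b t"
  shows "sym_converges N0 F (\<lambda>m. \<Sum>t\<in>T. b t * schur_fun (nu t) m)"
proof -
  \<comment> \<open>A sum bounds all degrees just as a maximum would, and makes sense for empty
    T.\<close>
  define D where "D = (\<Sum>t\<in>T. psize (nu t))"
  have D: "psize (nu t) \<le> D" if "t \<in> T" for t
    unfolding D_def using T(1) that by (intro member_le_sum) auto
  let ?G = "\<lambda>c m. \<Sum>t\<in>T. c t * schur_fun (nu t) m"
  have G: "?G c \<in> Sym_upto d" if "d \<ge> D" for d c
    using schur_fun_in_Sym[OF T(2)] Sym_upto_mono[OF order.trans[OF D that]]
    by (intro Sym_upto_sum) blast
  have spec: "F N = specialize N (?G (a N))" if "N \<ge> N0" for N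
  proof (rule poly_mapping_eqI)
    fix m
    show "Poly_Mapping.lookup (F N) m = Poly_Mapping.lookup (specialize N (?G (a N))) m"
    proof (cases "Poly_Mapping.keys m \<subseteq> {..<N}")
      case True
      have "schur_fun (nu t) m = Poly_Mapping.lookup (schur_poly (nu t) N) m" if "t \<in> T" for t
        using T(2,3)[OF that] True \<open>N \<ge> N0\<close> by (intro schur_fun_eq) auto
      thus ?thesis
        using that True by (simp add: lookup_specialize[OF G[OF order.refl]] F lookup_sum lookup_Const_mult)
    next
      case False
      hence "Poly_Mapping.lookup (schur_poly (nu t) N) m = 0" for t using keys_schur_poly by blast
      thus ?thesis
        using that False by (simp add: lookup_specialize[OF G[OF order.refl]] F lookup_sum lookup_Const_mult)
    qed
  qed
  have "(\<lambda>N. lift_sym d N (F N)) \<longlonglongrightarrow> ?G b" if "d \<ge> D" for d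
  proof -
    have "(\<lambda>N. ?G (a N)) \<longlonglongrightarrow> ?G b"
      unfolding tendsto_fun_iff by (intro allI tendsto_sum tendsto_mult lim tendsto_const)
    moreover have "eventually (\<lambda>N. ?G (a N) = lift_sym d N (F N)) sequentially"
      using eventually_ge_at_top[of "max N0 d"]
      by eventually_elim (use that in \<open>simp add: spec lift_sym_specialize G\<close>)
    ultimately show ?thesis by (rule Lim_transform_eventually)
  qed
  moreover have "F N \<in> Symp_upto D N" if "N \<ge> N0" for N
    unfolding F[OF that] using T(3) that
    by (intro Symp_upto_sum schur_poly_in_Symp T(2) D) (auto intro: order.trans)
  ultimately show ?thesis
    unfolding sym_converges_def Sym_def using G by blast
qed

section \<open>Triangular changes of basis for alternants\<close>

lemma alternant_eq_fdet:
  "alternant p lam N = fdet N (\<lambda>i j. poly (map_poly Const (p (beta N lam i))) (Var j))"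
  by (simp add: alternant_def beta_def)

lemma multivariateI:
  assumes "P * vandermonde N = alternant p lam N"
  shows "multivariate p lam N = P"
  unfolding multivariate_def
proof (rule the_equality)
  show "P * vandermonde N = alternant p lam N" by (rule assms)
  fix Q assume "Q * vandermonde N = alternant p lam N"
  hence "Q * vandermonde N = P * vandermonde N" by (simp add: assms)
  thus "Q = P" by (simp add: vandermonde_nonzero)
qed

lemma poly_map_Const_sum_smult:
  "poly (map_poly Const (\<Sum>k\<in>S. smult (a k) (r k))) x = (\<Sum>k\<in>S. Const (a k) * poly (map_poly Const (r k)) x)"
proof -
  interpret Const: comm_ring_hom Const by (rule comm_ring_hom_Const)
  have "map_poly Const (\<Sum>k\<in>S. smult (a k) (r k)) = (\<Sum>k\<in>S. smult (Const (a k)) (map_poly Const (r k)))"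
    by (rule poly_eqI) (simp add: coeff_map_poly coeff_sum Const.hom_sum Const.hom_mult)
  thus ?thesis by (simp add: poly_sum)
qed

lemma alternant_expansion:
  assumes p: "\<And>n. p n = (\<Sum>k\<le>n. smult (A n k) (r k))"
    and A: "\<And>n. A n n = 1" "\<And>n k. n < k \<Longrightarrow> A n k = 0"
    and lam: "is_partition lam" "plength lam \<le> N"
  shows "alternant p lam N = (\<Sum>mu | is_partition mu \<and> mu \<le> lam.
    Const (fdet (plength lam) (\<lambda>i k. A (beta N lam i) (beta N mu k))) * alternant r mu N)"
proof -
  \<comment> \<open>Large enough for every row index: beta N lam i is at most lam 0 + N - 1.\<close>
  define M where "M = lam 0 + N"
  let ?S = "{mu. is_partition mu \<and> mu \<le> lam}"
  let ?ev = "\<lambda>k j. poly (map_poly Const (r k)) (Var j)"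
  have anti: "antimono lam" using lam by (simp add: is_partition_def)
  have betaM: "beta N lam i < M" if "i < N" for i
    using antimonoD[OF anti, of 0 i] that by (simp add: beta_def M_def)
  have beta_anti: "beta N nu j \<le> beta N nu i" if "antimono nu" "i \<le> j" "j < N" for nu i j
    using beta_strict_decreasing[OF that(1), of i j N] that by (cases "i = j") auto
  have "alternant p lam N = fdet N (\<lambda>i j. \<Sum>k<M. Const (A (beta N lam i) k) * ?ev k j)"
    unfolding alternant_eq_fdet
  proof (rule fdet_cong)
    fix i j assume ij: "i < N" "j < N"
    have "p (beta N lam i) = (\<Sum>k<M. smult (A (beta N lam i) k) (r k))"
      unfolding p by (rule sum.mono_neutral_left) (use betaM[OF ij(1)] A in auto)
    thus "poly (map_poly Const (p (beta N lam i))) (Var j) =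
        (\<Sum>k<M. Const (A (beta N lam i) k) * ?ev k j)"
      by (simp add: poly_map_Const_sum_smult)
  qed
  also have "\<dots> = (\<Sum>mu\<in>box_partitions N M.
      fdet N (\<lambda>i k. Const (A (beta N lam i) (beta N mu k))) * fdet N (\<lambda>k. ?ev (beta N mu k)))"
    by (rule Cauchy_Binet)
  also have "\<dots> = (\<Sum>mu\<in>box_partitions N M.
      Const (fdet N (\<lambda>i k. A (beta N lam i) (beta N mu k))) * alternant r mu N)"
    by (simp only: hom_fdet[OF comm_ring_hom_Const] alternant_eq_fdet)
  also have "\<dots> = (\<Sum>mu\<in>?S. Const (fdet N (\<lambda>i k. A (beta N lam i) (beta N mu k))) * alternant r mu N)"
  proof (rule sum.mono_neutral_right)
    have "inj_on (\<lambda>mu. restrict mu {..<N}) (box_partitions N M)"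
    proof (rule inj_onI)
      fix mu nu assume *: "mu \<in> box_partitions N M" "nu \<in> box_partitions N M"
        and eq: "restrict mu {..<N} = restrict nu {..<N}"
      show "mu = nu"
      proof
        fix i show "mu i = nu i"
          using * fun_cong[OF eq, of i] by (cases "i < N") (auto simp: box_partitions_def)
      qed
    qed
    moreover have "mu i < M" if "mu \<in> box_partitions N M" "i < N" for mu i
    proof -
      have "beta N mu i < M" using that by (simp add: box_partitions_def)
      thus ?thesis using that(2) unfolding beta_def by linarith
    qed
    hence "(\<lambda>mu. restrict mu {..<N}) ` box_partitions N M \<subseteq> {..<N} \<rightarrow>\<^sub>E {..<M}"
      by (intro image_subsetI) (simp add: restrict_PiE_iff)
    ultimately show "finite (box_partitions N M)"
      by (meson finite_PiE finite_imageD finite_lessThan finite_subset)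
    show "?S \<subseteq> box_partitions N M"
    proof clarify
      fix mu assume mu: "is_partition mu" "mu \<le> lam"
      have "beta N mu i < M" if "i < N" for i
        using betaM[OF that] le_funD[OF mu(2), of i] by (simp add: beta_def)
      moreover have "mu i = 0" if "N \<le> i" for i
        using partition_eq_0[OF lam(1), of i] lam(2) le_funD[OF mu(2), of i] that by simp
      ultimately show "mu \<in> box_partitions N M"
        using mu(1) by (simp add: box_partitions_def is_partition_def)
    qed
    show "\<forall>mu\<in>box_partitions N M - ?S.
        Const (fdet N (\<lambda>i k. A (beta N lam i) (beta N mu k))) * alternant r mu N = 0"
    proof
      fix mu assume *: "mu \<in> box_partitions N M - ?S"
      hence mu: "antimono mu" "\<forall>i\<ge>N. mu i = 0" by (auto simp: box_partitions_def)
      have "{i. mu i \<noteq> 0} \<subseteq> {..<N}" using mu(2) by (auto simp: not_less[symmetric])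
      hence "is_partition mu" using mu(1) by (auto simp: is_partition_def intro: finite_subset)
      then obtain s where s: "lam s < mu s" using * by (auto simp: le_fun_def not_le)
      have "s < N" using s mu(2) by (metis not_less0 not_less)
      \<comment> \<open>If mu_s exceeds lam_s, all rows from s on have indices below those of all
        columns up to s, so triangularity of A gives a zero block meeting the diagonal.\<close>
      have "fdet N (\<lambda>i k. A (beta N lam i) (beta N mu k)) = 0"
      proof (rule fdet_zero_block[OF \<open>s < N\<close>])
        fix i k assume ik: "s \<le> i" "i < N" "k \<le> s"
        have "beta N lam i \<le> beta N lam s" by (rule beta_anti[OF anti ik(1,2)])
        also have "\<dots> < beta N mu s" using s \<open>s < N\<close> by (simp add: beta_def)
        also have "\<dots> \<le> beta N mu k" by (rule beta_anti[OF mu(1) ik(3) \<open>s < N\<close>])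
        finally show "A (beta N lam i) (beta N mu k) = 0" by (rule A)
      qed
      thus "Const (fdet N (\<lambda>i k. A (beta N lam i) (beta N mu k))) * alternant r mu N = 0"
        by (simp add: Const_def)
    qed
  qed
  also have "\<dots> = (\<Sum>mu\<in>?S. Const (fdet (plength lam) (\<lambda>i k. A (beta N lam i) (beta N mu k))) * alternant r mu N)"
  proof (intro sum.cong refl)
    fix mu assume "mu \<in> ?S"
    hence mu: "is_partition mu" "mu \<le> lam" by auto
    have lam0: "lam i = 0" if "plength lam \<le> i" for i by (rule partition_eq_0[OF lam(1) that])
    have mu0: "mu i = 0" if "plength lam \<le> i" for i using lam0[OF that] le_funD[OF mu(2), of i] by simp
    \<comment> \<open>Beyond the length of lam, row i and column i both have index N - 1 - i, giving
      a 1 on the diagonal, while the columns to the left have larger indices, giving 0.\<close>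
    have "fdet N (\<lambda>i k. A (beta N lam i) (beta N mu k)) =
        fdet (plength lam) (\<lambda>i k. A (beta N lam i) (beta N mu k))"
      by (rule fdet_reduce[OF lam(2)]) (auto simp: beta_def lam0 mu0 A)
    thus "Const (fdet N (\<lambda>i k. A (beta N lam i) (beta N mu k))) * alternant r mu N =
        Const (fdet (plength lam) (\<lambda>i k. A (beta N lam i) (beta N mu k))) * alternant r mu N" by simp
  qed
  finally show ?thesis .
qed

text \<open>Stated after multiplication by the Vandermonde product, so that the existence of the
  quotient for p follows from that for r.\<close>

lemma multivariate_expansion:
  assumes p: "\<And>n. p n = (\<Sum>k\<le>n. smult (A n k) (r k))"
    and A: "\<And>n. A n n = 1" "\<And>n k. n < k \<Longrightarrow> A n k = 0"
    and lam: "is_partition lam" "plength lam \<le> N"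
    and R: "\<And>mu. is_partition mu \<Longrightarrow> mu \<le> lam \<Longrightarrow> R mu * vandermonde N = alternant r mu N"
  shows "(\<Sum>mu | is_partition mu \<and> mu \<le> lam.
      Const (fdet (plength lam) (\<lambda>i k. A (beta N lam i) (beta N mu k))) * R mu) * vandermonde N =
    alternant p lam N"
proof -
  have "alternant p lam N = (\<Sum>mu | is_partition mu \<and> mu \<le> lam.
      Const (fdet (plength lam) (\<lambda>i k. A (beta N lam i) (beta N mu k))) * alternant r mu N)"
    by (rule alternant_expansion[OF p A lam])
  also have "\<dots> = (\<Sum>mu | is_partition mu \<and> mu \<le> lam.
      Const (fdet (plength lam) (\<lambda>i k. A (beta N lam i) (beta N mu k))) * (R mu * vandermonde N))"
    by (intro sum.cong refl) (simp add: R)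
  finally show ?thesis by (simp only: sum_distrib_right mult.assoc)
qed

lemma alternant_monom: "alternant (monom 1) mu N = power_alternant mu N"
proof -
  interpret Const: comm_ring_hom Const by (rule comm_ring_hom_Const)
  show ?thesis by (simp add: alternant_eq_fdet power_alternant_def map_poly_monom poly_monom)
qed

section \<open>Schur coefficients of interpolation polynomials\<close>

lemma degree_genpow: "degree (genpow cs n) = n"
  by (simp add: genpow_def degree_prod_eq_sum_degree)

lemma coeff_genpow_self: "coeff (genpow cs n) n = 1"
proof -
  have "lead_coeff (genpow cs n) = 1" by (simp add: genpow_def lead_coeff_prod)
  thus ?thesis by (simp add: degree_genpow)
qed

definition genpow_det :: "(nat \<Rightarrow> complex) \<Rightarrow> nat \<Rightarrow> (nat \<Rightarrow> nat) \<Rightarrow> (nat \<Rightarrow> nat) \<Rightarrow> complex" where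
  "genpow_det cs N mu nu =
     fdet (plength mu) (\<lambda>i k. coeff (genpow cs (beta N mu i)) (beta N nu k))"

lemma genpow_alternant:
  assumes "is_partition mu" "plength mu \<le> N"
  shows "(\<Sum>nu | is_partition nu \<and> nu \<le> mu. Const (genpow_det cs N mu nu) * schur_poly nu N) * vandermonde N =
    alternant (genpow cs) mu N"
  unfolding genpow_det_def
proof (rule multivariate_expansion[OF _ _ _ assms])
  show "genpow cs n = (\<Sum>k\<le>n. smult (coeff (genpow cs n) k) (monom 1 k))" for n
    using poly_as_sum_of_monoms[of "genpow cs n"] by (simp add: degree_genpow smult_monom)
qed (simp_all add: coeff_genpow_self coeff_eq_0 degree_genpow alternant_monom schur_poly_mult_vandermonde)

text \<open>The coefficient of x^k is homogeneous of degree n - k in the nodes; a power of t on each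
  side avoids subtraction and division.\<close>

lemma coeff_genpow_scale:
  "t ^ k * coeff (genpow (\<lambda>i. t * cs i) n) k = t ^ n * coeff (genpow cs n) k"
proof (induction n arbitrary: k)
  case (Suc n)
  have rec: "genpow cs (Suc n) = genpow cs n * [:- cs n, 1:]" for cs
    by (simp add: genpow_def mult.commute)
  show ?case
  proof (cases k)
    case 0
    thus ?thesis using Suc[of 0] by (simp add: rec)
  next
    case (Suc j)
    have "t ^ Suc n * coeff (genpow cs (Suc n)) k =
        t * (t ^ n * coeff (genpow cs n) j) - t * cs n * (t ^ n * coeff (genpow cs n) (Suc j))"
      by (simp add: rec Suc algebra_simps)
    also have "\<dots> = t * (t ^ j * coeff (genpow (\<lambda>i. t * cs i) n) j)
        - t * cs n * (t ^ Suc j * coeff (genpow (\<lambda>i. t * cs i) n) (Suc j))"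
      by (simp only: Suc.IH)
    also have "\<dots> = t ^ k * coeff (genpow (\<lambda>i. t * cs i) (Suc n)) k"
      by (simp add: rec Suc algebra_simps)
    finally show ?thesis by simp
  qed
next
  case 0
  show ?case by (cases k) (simp_all add: genpow_def)
qed

text \<open>The staircase contributes the same power of t to both products and cancels.\<close>

lemma prod_power_beta:
  fixes t :: complex
  assumes "t \<noteq> 0" "is_partition mu" "plength mu \<le> l" "is_partition nu" "plength nu \<le> l" "l \<le> N"
  shows "(\<Prod>i<l. t ^ beta N mu i) * (\<Prod>k<l. inverse (t ^ beta N nu k)) = t ^ psize mu / t ^ psize nu"
proof -
  have *: "(\<Prod>i<l. t ^ beta N mu i) = t ^ psize mu * (\<Prod>i<l. t ^ (N - 1 - i))"
    if "is_partition mu" "plength mu \<le> l" for mu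
  proof -
    have "(\<Prod>i<l. t ^ beta N mu i) = (\<Prod>i<l. t ^ mu i * t ^ (N - 1 - i))"
      using assms(6) by (intro prod.cong refl) (simp add: beta_def flip: power_add)
    thus ?thesis by (simp add: prod.distrib power_sum psize_superset[OF that])
  qed
  show ?thesis
    using prod_inversef[of "\<lambda>k. t ^ beta N nu k" "{..<l}"] *[OF assms(2,3)] *[OF assms(4,5)] assms(1)
    by (simp add: o_def field_simps)
qed

lemma genpow_det_scale:
  assumes t: "t \<noteq> 0" and mu: "is_partition mu" "plength mu \<le> N" and nu: "is_partition nu" "nu \<le> mu"
  shows "genpow_det (\<lambda>i. t * cs i) N mu nu = t ^ psize mu / t ^ psize nu * genpow_det cs N mu nu"
proof -
  have "coeff (genpow (\<lambda>i. t * cs i) n) k = t ^ n * coeff (genpow cs n) k * inverse (t ^ k)" for n k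
    using coeff_genpow_scale[of t k cs n] t by (simp add: field_simps)
  hence "genpow_det (\<lambda>i. t * cs i) N mu nu = (\<Prod>i<plength mu. t ^ beta N mu i) *
      (\<Prod>k<plength mu. inverse (t ^ beta N nu k)) * genpow_det cs N mu nu"
    unfolding genpow_det_def by (simp only: fdet_scale_rows_columns)
  thus ?thesis
    using prod_power_beta[OF t mu(1) order.refl nu(1) plength_mono[OF nu(1) mu(1) nu(2)] mu(2)] by simp
qed

text \<open>The first n nodes q^(N-1), q^(N-2), ... read backwards start at q^(N-n). For n = beta N
  mu i this exponent is 1 + i - mu_i, free of N, so letting N grow only appends factors at the far
  end.\<close>

definition geometric_prod :: "complex \<Rightarrow> int \<Rightarrow> nat \<Rightarrow> complex poly" where
  "geometric_prod q s = genpow (\<lambda>j. q powi (s + int j))"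

lemma geometric_prod_eq_genpow:
  "genpow (\<lambda>i. q powi (int N - 1 - int i)) n = geometric_prod q (int N - int n) n"
proof -
  have "genpow (\<lambda>i. q powi (int N - 1 - int i)) n =
      (\<Prod>i<n. [:- (q powi (int N - 1 - int (n - Suc i))), 1:])"
    unfolding genpow_def by (rule prod.nat_diff_reindex[symmetric])
  also have "\<dots> = geometric_prod q (int N - int n) n"
    unfolding geometric_prod_def genpow_def
    by (intro prod.cong refl) (simp add: of_nat_diff algebra_simps)
  finally show ?thesis .
qed

text \<open>Up to sign the coefficient is the r-th elementary symmetric polynomial in the first n +
  r powers of q from q^s on. Appending a power changes it by that power times a value of the
  previous order, which is bounded by induction, so the increments are dominated by a geometric
  series.\<close>

lemma convergent_coeff_geometric_prod:
  assumes q: "q \<noteq> 0" "norm q < 1"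
  shows "convergent (\<lambda>n. coeff (geometric_prod q s (n + r)) n)"
proof (induction r)
  case 0
  show ?case by (simp add: geometric_prod_def coeff_genpow_self convergent_const)
next
  case (Suc r)
  define b where "b n = coeff (geometric_prod q s (n + r)) n" for n
  define c where "c n = coeff (geometric_prod q s (n + Suc r)) n" for n
  have diff: "c (Suc n) - c n = - (q powi (s + int (Suc n + r))) * b (Suc n)" for n
  proof -
    have "geometric_prod q s (Suc (Suc n + r)) =
        geometric_prod q s (Suc n + r) * [:- (q powi (s + int (Suc n + r))), 1:]"
      unfolding geometric_prod_def genpow_def by (simp only: prod.lessThan_Suc)
    from arg_cong[OF this, of "\<lambda>p. coeff p (Suc n)"] show ?thesis
      by (simp add: b_def c_def algebra_simps)
  qed
  obtain B where B: "\<And>n. norm (b n) \<le> B" "B > 0"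
    using convergent_imp_Bseq[OF Suc] unfolding b_def [symmetric] by (auto elim!: BseqE)
  have "summable (\<lambda>n. c (Suc n) - c n)"
  proof (rule summable_comparison_test')
    show "summable (\<lambda>n. norm (q powi (s + 1 + int r)) * B * norm q ^ n)"
      using q by (intro summable_mult summable_geometric) simp
    fix n :: nat assume "n \<ge> 0"
    have "s + int (Suc n + r) = (s + 1 + int r) + int n" by simp
    hence "q powi (s + int (Suc n + r)) = q powi (s + 1 + int r) * q ^ n"
      using q by (simp only: power_int_add power_int_of_nat simp_thms)
    hence "norm (c (Suc n) - c n) = norm (q powi (s + 1 + int r)) * norm q ^ n * norm (b (Suc n))"
      by (simp only: diff norm_mult norm_minus_cancel norm_power)
    also have "\<dots> \<le> norm (q powi (s + 1 + int r)) * norm q ^ n * B"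
      by (intro mult_left_mono B) simp
    finally show "norm (c (Suc n) - c n) \<le> norm (q powi (s + 1 + int r)) * B * norm q ^ n"
      by (simp add: mult_ac)
  qed
  hence "convergent (\<lambda>n. \<Sum>i<n. c (Suc i) - c i)" by (simp add: summable_iff_convergent)
  hence "convergent (\<lambda>n. c n - c 0)" by (simp only: sum_lessThan_telescope)
  hence "convergent (\<lambda>n. (c n - c 0) + c 0)" by (intro convergent_add convergent_const)
  thus ?case by (simp add: c_def)
qed

lemma filterlim_beta: "filterlim (\<lambda>N. beta N mu k) at_top at_top"
  by (rule filterlim_at_top_mono[OF filterlim_minus_const_nat_at_top[of "Suc k"]])
     (auto simp: beta_def eventually_at_top_linorder intro!: exI[of _ 0])

lemma convergent_genpow_coeff_beta:
  assumes q: "q \<noteq> 0" "norm q < 1"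
  shows "convergent (\<lambda>N. coeff (genpow (\<lambda>i. q powi (int N - 1 - int i)) (beta N mu i)) (beta N nu k))"
    (is "convergent ?f")
proof (cases "nu k + i \<le> mu i + k")
  case True
  \<comment> \<open>Both indices grow with N, but their difference \<open>r\<close> and the starting
    exponent \<open>s\<close> stay fixed.\<close>
  define r where "r = mu i + k - (nu k + i)"
  define s where "s = 1 + int i - int (mu i)"
  obtain L where "(\<lambda>n. coeff (geometric_prod q s (n + r)) n) \<longlonglongrightarrow> L"
    using convergent_coeff_geometric_prod[OF q, of s r] by (auto simp: convergent_def)
  from filterlim_compose[OF this filterlim_beta[of nu k]]
  have lim: "(\<lambda>N. coeff (geometric_prod q s (beta N nu k + r)) (beta N nu k)) \<longlonglongrightarrow> L" .
  have "eventually (\<lambda>N. coeff (geometric_prod q s (beta N nu k + r)) (beta N nu k) = ?f N) sequentially"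
    using eventually_gt_at_top[of "max i k"]
  proof eventually_elim
    case (elim N)
    have "beta N mu i = beta N nu k + r" using elim True by (simp add: beta_def r_def)
    moreover have "int N - int (beta N mu i) = s" using elim by (simp add: beta_def s_def)
    ultimately show ?case by (simp only: geometric_prod_eq_genpow)
  qed
  from Lim_transform_eventually[OF lim this] show ?thesis by (auto simp: convergent_def)
next
  case False
  have "eventually (\<lambda>N. 0 = ?f N) sequentially"
    using eventually_gt_at_top[of "max i k"]
  proof eventually_elim
    case (elim N)
    from elim have "i < N" "k < N" by simp_all
    hence "beta N mu i < beta N nu k" using False unfolding beta_def by linarith
    thus ?case by (simp add: coeff_eq_0 degree_genpow)
  qed
  from Lim_transform_eventually[OF tendsto_const this] show ?thesis by (auto simp: convergent_def)
qed

definition interp_coeff :: "complex \<Rightarrow> (nat \<Rightarrow> nat) \<Rightarrow> (nat \<Rightarrow> nat) \<Rightarrow> complex" where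
  "interp_coeff q mu nu = lim (\<lambda>N. genpow_det (\<lambda>i. q powi (int N - 1 - int i)) N mu nu)"

lemma tendsto_interp_coeff:
  assumes q: "q \<noteq> 0" "norm q < 1"
  shows "(\<lambda>N. genpow_det (\<lambda>i. q powi (int N - 1 - int i)) N mu nu) \<longlonglongrightarrow> interp_coeff q mu nu"
proof -
  let ?f = "\<lambda>N i k. coeff (genpow (\<lambda>i. q powi (int N - 1 - int i)) (beta N mu i)) (beta N nu k)"
  have "(\<lambda>N. ?f N i k) \<longlonglongrightarrow> lim (\<lambda>N. ?f N i k)" for i k
    using convergent_genpow_coeff_beta[OF q] by (simp only: convergent_LIMSEQ_iff)
  hence "(\<lambda>N. fdet (plength mu) (?f N)) \<longlonglongrightarrow> fdet (plength mu) (\<lambda>i k. lim (\<lambda>N. ?f N i k))"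
    by (intro tendsto_fdet)
  hence "convergent (\<lambda>N. genpow_det (\<lambda>i. q powi (int N - 1 - int i)) N mu nu)"
    by (auto simp: convergent_def genpow_det_def)
  thus ?thesis by (simp only: convergent_LIMSEQ_iff interp_coeff_def)
qed

text \<open>Uniqueness of limits turns the \<open>THE\<close> in \<open>interp_sym\<close> into an
  explicit Schur expansion.\<close>

lemma interp_sym_eq:
  assumes q: "q \<noteq> 0" "norm q < 1" and mu: "is_partition mu"
  shows "interp_sym mu q = (\<lambda>m. \<Sum>nu | is_partition nu \<and> nu \<le> mu. interp_coeff q mu nu * schur_fun nu m)"
proof -
  have "sym_converges (plength mu) (\<lambda>N. interp_poly mu N (\<lambda>i. q powi (int N - 1 - int i)))
      (\<lambda>m. \<Sum>nu\<in>{nu. is_partition nu \<and> nu \<le> mu}. interp_coeff q mu nu * schur_fun nu m)"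
  proof (rule sym_converges_schur_expansion)
    show "finite {nu. is_partition nu \<and> nu \<le> mu}" by (rule finite_subpartitions[OF mu])
    show "interp_poly mu N (\<lambda>i. q powi (int N - 1 - int i)) = (\<Sum>nu | is_partition nu \<and> nu \<le> mu.
        Const (genpow_det (\<lambda>i. q powi (int N - 1 - int i)) N mu nu) * schur_poly nu N)"
      if "plength mu \<le> N" for N
      unfolding interp_poly_def by (intro multivariateI genpow_alternant mu that)
  qed (use plength_mono[OF _ mu] tendsto_interp_coeff[OF q] in auto)
  thus ?thesis
    unfolding interp_sym_def by (intro the_equality) (auto intro: sym_converges_unique)
qed

section \<open>Expansion of the $q$-Meixner polynomials\<close>

lemma qpoch_add: "qpoch x q (k + n) = qpoch x q k * qpoch (x * q ^ k) q n"
  by (induction n) (simp_all add: qpoch_def power_add mult_ac)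

lemma qpoch_self_nonzero:
  fixes q :: complex
  assumes "norm q < 1"
  shows "qpoch q q n \<noteq> 0"
proof -
  have "q * q ^ k \<noteq> 1" for k
  proof
    assume "q * q ^ k = 1"
    hence "norm q ^ Suc k = 1" by (metis norm_one norm_power power_Suc)
    moreover have "norm q * norm q ^ k \<le> norm q * 1"
      using assms by (intro mult_left_mono power_le_one) auto
    ultimately show False using assms by simp
  qed
  thus ?thesis by (simp add: qpoch_def)
qed

text \<open>Each factor is 1 - q^(i-n) = -q^(i-n) (1 - q^(n-i)), so (q^-n; q)_k is a signed power of
  q times (q; q)_n / (q; q)_(n-k).\<close>

lemma qpoch_inverse_power:
  fixes q :: complex
  assumes q: "q \<noteq> 0" and "k \<le> n"
  shows "qpoch (q powi (- int n)) q k * qpoch q q (n - k) =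
    (\<Prod>i<k. - (q ^ i / q ^ n)) * qpoch q q n"
  using assms(2)
proof (induction k)
  case 0
  thus ?case by (simp add: qpoch_def)
next
  case (Suc k)
  define r where "r = n - Suc k"
  have n: "n = r + Suc k" using Suc.prems by (simp add: r_def)
  have "qpoch (q powi (- int n)) q (Suc k) * qpoch q q r =
      (qpoch (q powi (- int n)) q k * qpoch q q r) * (1 - q ^ k / q ^ n)"
    by (simp add: qpoch_def power_int_minus divide_inverse mult_ac)
  also have "1 - q ^ k / q ^ n = - (q ^ k / q ^ n) * (1 - q * q ^ r)"
    using q by (simp add: n power_add field_simps)
  also have "(qpoch (q powi (- int n)) q k * qpoch q q r) * (- (q ^ k / q ^ n) * (1 - q * q ^ r)) =
      (qpoch (q powi (- int n)) q k * qpoch q q (Suc r)) * - (q ^ k / q ^ n)"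
    by (simp add: qpoch_def mult_ac)
  also have "qpoch (q powi (- int n)) q k * qpoch q q (Suc r) =
      (\<Prod>i<k. - (q ^ i / q ^ n)) * qpoch q q n"
    using Suc by (simp add: n)
  finally show ?case by (simp add: r_def mult_ac)
qed

lemma qpoch_poly_eq_genpow:
  fixes q c :: complex
  assumes "q \<noteq> 0" "c \<noteq> 0"
  shows "qpoch [:0, c:] [:q:] k = smult (\<Prod>i<k. - (c * q ^ i)) (genpow (\<lambda>i. inverse (c * q ^ i)) k)"
proof (induction k)
  case (Suc k)
  have "[:q:] ^ n = [:q ^ n:]" for n by (induction n) (simp_all add: one_pCons)
  hence "1 - [:0, c:] * [:q:] ^ k = smult (- (c * q ^ k)) [:- inverse (c * q ^ k), 1:]"
    using assms by (simp add: one_pCons field_simps)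
  thus ?case using Suc unfolding qpoch_def genpow_def prod.lessThan_Suc
    by (simp only: mult_smult_left mult_smult_right smult_smult mult.commute)
qed (simp add: qpoch_def genpow_def)

text \<open>The first k odd numbers sum to k^2.\<close>

lemma prod_odd_power:
  fixes x q :: complex
  shows "(\<Prod>i<k. x * q ^ (2 * i + 1)) = (x * q ^ k) ^ k"
proof (induction k)
  case (Suc k)
  have "(\<Prod>i<Suc k. x * q ^ (2 * i + 1)) = x ^ Suc k * q ^ (k * k + 2 * k + 1)"
    using Suc by (simp add: power_mult_distrib power_add power_mult mult_ac)
  also have "k * k + 2 * k + 1 = Suc k * Suc k" by simp
  also have "x ^ Suc k * q ^ (Suc k * Suc k) = (x * q ^ Suc k) ^ Suc k"
    by (simp only: power_mult_distrib power_mult)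
  finally show ?case .
qed simp

text \<open>Collects the part of the transition coefficient that splits into a factor in n and a
  factor in k, so that it can be pulled out of minors as row and column factors.\<close>

definition meixner_norm :: "complex \<Rightarrow> complex \<Rightarrow> complex \<Rightarrow> complex \<Rightarrow> nat \<Rightarrow> complex" where
  "meixner_norm q a c d n = (a / (c * d * q ^ n)) ^ n * qpoch q q n"

definition meixner_coeff :: "complex \<Rightarrow> complex \<Rightarrow> complex \<Rightarrow> complex \<Rightarrow> nat \<Rightarrow> nat \<Rightarrow> complex" where
  "meixner_coeff q a c d n k =
     (if k \<le> n then meixner_norm q a c d n *
        (qpoch (c / a * q ^ (k + 1)) q (n - k) / qpoch q q (n - k)) *
        inverse (meixner_norm q a c d k) else 0)"

lemma meixner_norm_nonzero:
  assumes "q \<noteq> 0" "norm q < 1" "a \<noteq> 0" "c \<noteq> 0" "d \<noteq> 0"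
  shows "meixner_norm q a c d n \<noteq> 0"
  using assms qpoch_self_nonzero by (simp add: meixner_norm_def)

lemma meixner_coeff_self:
  assumes "q \<noteq> 0" "norm q < 1" "a \<noteq> 0" "c \<noteq> 0" "d \<noteq> 0"
  shows "meixner_coeff q a c d n n = 1"
  using meixner_norm_nonzero[OF assms] by (simp add: meixner_coeff_def qpoch_def)

text \<open>The prefactor (cq/a; q)_n absorbs the denominator (cq/a; q)_k of the series, leaving
  (cq^(k+1)/a; q)_(n-k); \<open>regular\<close> is what allows this cancellation.\<close>

lemma qMeixner_expansion:
  assumes nz: "q \<noteq> 0" "norm q < 1" "a \<noteq> 0" "c \<noteq> 0" "d \<noteq> 0"
    and regular: "\<And>k. qpoch (c * q / a) q k \<noteq> 0"
  shows "qMeixner q a c d n =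
    (\<Sum>k\<le>n. smult (meixner_coeff q a c d n k) (genpow (\<lambda>i. inverse (c * q ^ i)) k))"
proof -
  have coeff: "qpoch (c * q / a) q n * (a / (c * d * q ^ n)) ^ n *
      (qpoch (q powi (- int n)) q k / (qpoch (c * q / a) q k * qpoch q q k) * (d / a * q ^ (n + 1)) ^ k *
        (\<Prod>i<k. - (c * q ^ i))) = meixner_coeff q a c d n k" if "k \<le> n" for k
  proof -
    have neg: "qpoch (q powi (- int n)) q k = (\<Prod>i<k. - (q ^ i / q ^ n)) * qpoch q q n / qpoch q q (n - k)"
      using qpoch_inverse_power[OF nz(1) that] qpoch_self_nonzero[OF nz(2)]
      by (simp add: eq_divide_eq)
    have split: "qpoch (c * q / a) q n = qpoch (c * q / a) q k * qpoch (c / a * q ^ (k + 1)) q (n - k)"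
      using qpoch_add[of "c * q / a" q k "n - k"] that by (simp add: mult_ac)
    \<comment> \<open>Taken together, the i-th factors of the three products give (cd/a) q^(2i+1): n
      drops out, so what remains depends on k alone.\<close>
    have "(\<Prod>i<k. - (q ^ i / q ^ n)) * (d / a * q ^ (n + 1)) ^ k * (\<Prod>i<k. - (c * q ^ i)) =
        (\<Prod>i<k. - (q ^ i / q ^ n) * (d / a * q ^ (n + 1)) * - (c * q ^ i))"
      by (simp only: prod.distrib prod_constant card_lessThan power_mult_distrib)
    also have "\<dots> = (\<Prod>i<k. c * d / a * q ^ (2 * i + 1))"
      using nz(1) by (intro prod.cong refl) (simp add: mult_2 mult_2_right power_add field_simps)
    also have "\<dots> = (c * d / a * q ^ k) ^ k" by (rule prod_odd_power)
    also have "\<dots> = inverse ((a / (c * d * q ^ k)) ^ k)"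
      by (simp flip: power_inverse)
    finally have powers: "(\<Prod>i<k. - (q ^ i / q ^ n)) * (d / a * q ^ (n + 1)) ^ k * (\<Prod>i<k. - (c * q ^ i)) =
        inverse ((a / (c * d * q ^ k)) ^ k)" .
    have "qpoch (c * q / a) q n * (a / (c * d * q ^ n)) ^ n *
        (qpoch (q powi (- int n)) q k / (qpoch (c * q / a) q k * qpoch q q k) * (d / a * q ^ (n + 1)) ^ k *
          (\<Prod>i<k. - (c * q ^ i))) =
        qpoch (c / a * q ^ (k + 1)) q (n - k) * (a / (c * d * q ^ n)) ^ n *
        (qpoch q q n / qpoch q q (n - k) / qpoch q q k *
          ((\<Prod>i<k. - (q ^ i / q ^ n)) * (d / a * q ^ (n + 1)) ^ k * (\<Prod>i<k. - (c * q ^ i))))"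
      unfolding neg split using regular[of k] by simp
    also have "\<dots> = meixner_coeff q a c d n k"
      unfolding powers using that by (simp add: meixner_coeff_def meixner_norm_def divide_inverse mult_ac)
    finally show ?thesis .
  qed
  have smult_sum: "smult x (sum F S) = (\<Sum>k\<in>S. smult x (F k))" for x and F :: "nat \<Rightarrow> complex poly" and S
    by (induction S rule: infinite_finite_induct) (simp_all add: smult_add_right)
  show ?thesis
    unfolding qMeixner_def smult_sum qpoch_poly_eq_genpow[OF nz(1,4)] smult_smult
    by (intro sum.cong refl) (simp only: coeff mult.assoc[symmetric] atMost_iff, simp add: coeff[symmetric] mult.assoc)
qed

text \<open>Count the boxes of the diagram weighted by column number: by columns this is n(mu'), by
  rows it is the sum of mu_i (mu_i - 1) / 2.\<close>

lemma sum_partition_squares: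
  assumes mu: "is_partition mu" "plength mu \<le> N"
  shows "2 * int (pweight (ptranspose mu)) = (\<Sum>i<N. int (mu i) * int (mu i)) - int (psize mu)"
proof -
  have anti: "antimono mu" and fin: "finite {i. mu i \<noteq> 0}"
    using mu by (auto simp: is_partition_def)
  have sub: "{i. j < mu i} = {i\<in>{..<N}. j < mu i}" for j
    using partition_eq_0[OF mu(1)] mu(2) by (auto simp: not_less[symmetric])
       (metis le_trans not_le not_less0)
  have "{j. ptranspose mu j \<noteq> 0} = {..<mu 0}"
  proof (intro equalityI subsetI)
    fix j assume "j \<in> {j. ptranspose mu j \<noteq> 0}"
    hence "card {i. j < mu i} \<noteq> 0" by (simp add: ptranspose_def)
    hence "{i. j < mu i} \<noteq> {}" by (metis card.empty)
    then obtain i where "j < mu i" by auto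
    thus "j \<in> {..<mu 0}" using antimonoD[OF anti, of 0 i] by simp
  next
    fix j assume "j \<in> {..<mu 0}"
    hence "{i. j < mu i} \<noteq> {}" by auto
    moreover have "finite {i. j < mu i}" by (subst sub) simp
    ultimately have "card {i. j < mu i} \<noteq> 0" by (meson card_0_eq)
    thus "j \<in> {j. ptranspose mu j \<noteq> 0}" by (simp add: ptranspose_def)
  qed
  hence "pweight (ptranspose mu) = (\<Sum>j<mu 0. j * card {i. j < mu i})"
    by (simp add: pweight_def plength_def ptranspose_def)
  also have "\<dots> = (\<Sum>j<mu 0. \<Sum>i<N. if j < mu i then j else 0)"
  proof (intro sum.cong refl)
    fix j
    have "(\<Sum>i<N. if j < mu i then j else 0) = (\<Sum>i\<in>{i\<in>{..<N}. j < mu i}. j)"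
      by (rule sum.inter_filter[symmetric]) simp
    also have "\<dots> = j * card {i. j < mu i}"
      unfolding sub[symmetric] by (simp add: mult.commute)
    finally show "j * card {i. j < mu i} = (\<Sum>i<N. if j < mu i then j else 0)" ..
  qed
  also have "\<dots> = (\<Sum>i<N. \<Sum>j<mu 0. if j < mu i then j else 0)" by (rule sum.swap)
  also have "\<dots> = (\<Sum>i<N. \<Sum>j<mu i. j)"
  proof (rule sum.cong[OF refl])
    fix i
    have "{..<mu i} = {j\<in>{..<mu 0}. j < mu i}" using antimonoD[OF anti, of 0 i] by auto
    show "(\<Sum>j<mu 0. if j < mu i then j else 0) = (\<Sum>j<mu i. j)"
      unfolding \<open>{..<mu i} = _\<close> by (rule sum.inter_filter[symmetric]) simp
  qed
  finally have weight: "pweight (ptranspose mu) = (\<Sum>i<N. \<Sum>j<mu i. j)" .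
  have gauss: "2 * int (\<Sum>j<n. j) = int n * int n - int n" for n
    by (induction n) (simp_all add: algebra_simps)
  have "2 * int (pweight (ptranspose mu)) = (\<Sum>i<N. 2 * int (\<Sum>j<mu i. j))"
    by (simp add: weight sum_distrib_left)
  also have "\<dots> = (\<Sum>i<N. int (mu i) * int (mu i) - int (mu i))" by (simp only: gauss)
  finally show ?thesis by (simp add: sum_subtractf psize_superset[OF mu])
qed

lemma pweight_superset:
  assumes "is_partition mu" "plength mu \<le> N"
  shows "int (pweight mu) = (\<Sum>i<N. int i * int (mu i))"
  unfolding pweight_def by (subst sum_partition_superset[OF assms, of "\<lambda>i x. i * x"]) simp_all

text \<open>With n = beta N lam i the exponent (2N - 2)n - n^2 of q in \<open>g n\<close> equals
  (N-1)^2 - (lam_i - i)^2. The first square cancels in the quotient, so N disappears; the second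
  gives the partition statistics.\<close>

lemma prod_meixner_power:
  fixes q a c d :: complex
  assumes nz: "q \<noteq> 0" "a \<noteq> 0" "c \<noteq> 0" "d \<noteq> 0"
    and lam: "is_partition lam" "plength lam \<le> l" and mu: "is_partition mu" "plength mu \<le> l"
    and N: "l \<le> N"
  defines "g \<equiv> \<lambda>n. (a / ((c * q powi (1 - int N)) * (d * q powi (1 - int N)) * q ^ n)) ^ n"
  shows "(\<Prod>i<l. g (beta N lam i) / g (beta N mu i)) =
    c powi (int (psize mu) - int (psize lam)) *
    (a / (q * d)) powi (int (psize lam) - int (psize mu)) *
    q powi (2 * (int (pweight (ptranspose mu)) - int (pweight mu)
                    - int (pweight (ptranspose lam)) + int (pweight lam)))"
proof -
  define u where "u = a / (c * d)"
  have u: "u \<noteq> 0" using nz by (simp add: u_def)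
  have g: "g n = u powi int n * q powi ((2 * int N - 2) * int n - int n * int n)" for n
  proof -
    have "q powi (1 - int N) * q powi (1 - int N) * q ^ n = q powi (2 - 2 * int N + int n)"
      using nz(1) by (simp flip: power_int_add power_int_of_nat)
    hence "c * q powi (1 - int N) * (d * q powi (1 - int N)) * q ^ n = c * d * q powi (2 - 2 * int N + int n)"
      by (simp add: mult_ac)
    hence "a / (c * q powi (1 - int N) * (d * q powi (1 - int N)) * q ^ n) =
        u * q powi (- (2 - 2 * int N + int n))"
      by (simp only: power_int_minus u_def) (simp add: field_simps)
    also have "\<dots> ^ n = u ^ n * (q powi (- (2 - 2 * int N + int n))) powi int n"
      by (simp add: power_mult_distrib)
    also have "(q powi (- (2 - 2 * int N + int n))) powi int n =
        q powi ((2 * int N - 2) * int n - int n * int n)"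
      unfolding power_int_mult[symmetric] by (simp add: algebra_simps)
    finally show ?thesis by (simp add: g_def)
  qed
  let ?e = "\<lambda>i. 2 * int i * (int (lam i) - int (mu i)) - int (lam i) * int (lam i) + int (mu i) * int (mu i)"
  have ratio: "g (beta N lam i) / g (beta N mu i) = u powi (int (lam i) - int (mu i)) * q powi ?e i"
    if "i < l" for i
  proof -
    have beta: "int (beta N nu i) = int (nu i) + int N - 1 - int i" for nu
      using that N by (simp add: beta_def)
    have "g (beta N lam i) / g (beta N mu i) =
        u powi (int (beta N lam i) - int (beta N mu i)) *
        q powi (((2 * int N - 2) * int (beta N lam i) - int (beta N lam i) * int (beta N lam i)) -
          ((2 * int N - 2) * int (beta N mu i) - int (beta N mu i) * int (beta N mu i)))"
      unfolding g using nz(1) u by (simp only: power_int_diff simp_thms) (simp add: field_simps)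
    also have "int (beta N lam i) - int (beta N mu i) = int (lam i) - int (mu i)"
      by (simp add: beta)
    also have "((2 * int N - 2) * int (beta N lam i) - int (beta N lam i) * int (beta N lam i)) -
          ((2 * int N - 2) * int (beta N mu i) - int (beta N mu i) * int (beta N mu i)) = ?e i"
      unfolding beta by (simp add: algebra_simps)
    finally show ?thesis .
  qed
  \<comment> \<open>Replacing sums of squares by n(mu') and n(lam') leaves over q^(-D) with D =
    |lam| - |mu|; it turns a/(cd) into a/(qd) up to the power of c.\<close>
  have regroup: "u powi D * q powi (E - D) = c powi (- D) * (a / (q * d)) powi D * q powi E" for D E
    using nz by (simp add: u_def power_int_diff power_int_minus power_int_mult_distrib
      power_int_divide_distrib field_simps)
  have prod_powi: "(\<Prod>i\<in>S. x powi f i) = x powi (\<Sum>i\<in>S. f i)"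
    if "x \<noteq> 0" "finite S" for x :: complex and f :: "nat \<Rightarrow> int" and S
    using that(2,1) by (induction S rule: finite_induct) (simp_all add: power_int_add)
  have "(\<Prod>i<l. g (beta N lam i) / g (beta N mu i)) =
      u powi (\<Sum>i<l. int (lam i) - int (mu i)) * q powi (\<Sum>i<l. ?e i)"
    using u nz(1) by (simp add: ratio prod.distrib prod_powi)
  also have "(\<Sum>i<l. int (lam i) - int (mu i)) = int (psize lam) - int (psize mu)"
    by (simp add: sum_subtractf psize_superset[OF lam] psize_superset[OF mu])
  also have "(\<Sum>i<l. ?e i) = 2 * ((\<Sum>i<l. int i * int (lam i)) - (\<Sum>i<l. int i * int (mu i)))
      - (\<Sum>i<l. int (lam i) * int (lam i)) + (\<Sum>i<l. int (mu i) * int (mu i))"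
    by (simp add: sum.distrib sum_subtractf sum_distrib_left right_diff_distrib mult.assoc)
  also have "\<dots> = 2 * (int (pweight (ptranspose mu)) - int (pweight mu)
                    - int (pweight (ptranspose lam)) + int (pweight lam))
      - (int (psize lam) - int (psize mu))"
    using sum_partition_squares[OF lam] sum_partition_squares[OF mu]
      pweight_superset[OF lam] pweight_superset[OF mu] by (simp add: algebra_simps)
  finally show ?thesis by (simp only: regroup minus_diff_eq)
qed

text \<open>The quotient is a product of a fixed number lam_i - mu_i of factors 1 - q^e whose
  exponents e all tend to infinity.\<close>

lemma tendsto_qpoch_ratio:
  fixes q :: complex
  assumes q: "norm q < 1" and le: "mu i \<le> lam i"
  shows "(\<lambda>N. qpoch q q (beta N lam i) / qpoch q q (beta N mu i)) \<longlonglongrightarrow> 1"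
proof -
  have "(\<lambda>n. qpoch (q * q ^ n) q r) \<longlonglongrightarrow> (\<Prod>k<r. 1 - q * 0 * q ^ k)" for r
    unfolding qpoch_def by (intro tendsto_intros LIMSEQ_power_zero q)
  hence "(\<lambda>n. qpoch (q * q ^ n) q (lam i - mu i)) \<longlonglongrightarrow> 1" by simp
  from filterlim_compose[OF this filterlim_beta[of mu i]]
  have "(\<lambda>N. qpoch (q * q ^ beta N mu i) q (lam i - mu i)) \<longlonglongrightarrow> 1" .
  moreover have "eventually (\<lambda>N. qpoch (q * q ^ beta N mu i) q (lam i - mu i) =
      qpoch q q (beta N lam i) / qpoch q q (beta N mu i)) sequentially"
    using eventually_gt_at_top[of i]
  proof eventually_elim
    case (elim N)
    have "beta N lam i = beta N mu i + (lam i - mu i)" using le elim by (simp add: beta_def)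
    thus ?case using qpoch_self_nonzero[OF q] by (simp add: qpoch_add)
  qed
  ultimately show ?thesis by (rule Lim_transform_eventually)
qed

text \<open>The shift q^(1-N) of c and the N in the column index cancel: 1 - N + (beta N mu k + 1) =
  mu_k + 1 - k.\<close>

lemma meixner_coeff_beta:
  assumes nz: "q \<noteq> 0" and N: "i < N" "k < N"
  shows "meixner_coeff q a (c * q powi (1 - int N)) d (beta N lam i) (beta N mu k) =
    meixner_norm q a (c * q powi (1 - int N)) d (beta N lam i) *
    sigma_entry lam mu q a c i k *
    inverse (meixner_norm q a (c * q powi (1 - int N)) d (beta N mu k))"
proof -
  have beta: "int (beta N nu j) = int (nu j) + int N - 1 - int j" if "j < N" for nu j
    using that by (simp add: beta_def)
  have r: "int (lam i) - int i - int (mu k) + int k = int (beta N lam i) - int (beta N mu k)"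
    using N by (simp add: beta)
  have diff: "nat (int x - int y) = x - y" for x y :: nat by (simp add: nat_minus_as_int)
  have "q powi (1 - int N) * q ^ (beta N mu k + 1) = q powi (1 - int N + int (beta N mu k + 1))"
    using nz by (simp only: power_int_add power_int_of_nat simp_thms)
  also have "1 - int N + int (beta N mu k + 1) = int (mu k) + 1 - int k"
    using N by (simp add: beta)
  finally have base: "c * q powi (1 - int N) / a * q ^ (beta N mu k + 1) = c / a * q powi (int (mu k) + 1 - int k)"
    by (simp add: mult_ac)
  thus ?thesis
    unfolding meixner_coeff_def sigma_entry_def Let_def r base by (simp add: diff)
qed

text \<open>Admissibility enters only through \<open>c, d \<noteq> 0\<close> and the non-vanishing of all denominators
  \<open>(cq\<^sup>2\<^sup>-\<^sup>N/a; q)\<^sub>k\<close>.\<close>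

lemma admissible_nonzero:
  assumes q: "0 < q" "q < 1" and adm: "admissible q a c d"
  shows "a > 0" "c \<noteq> 0" "d \<noteq> 0"
proof -
  show a: "a > 0" using adm by (simp add: admissible_def)
  have pos: "a * q powi m > 0" for m using a q by simp
  have "c \<noteq> 0 \<and> d \<noteq> 0"
    using adm unfolding admissible_def
  proof (elim conjE disjE exE)
    fix c' d' m assume "c = of_real c'" "d = of_real d'" "a * q powi m < c'" "a * q powi m < d'"
    thus ?thesis using pos[of m] by auto
  qed auto
  thus "c \<noteq> 0" "d \<noteq> 0" by auto
qed

text \<open>Nonreal and negative c miss the positive points a q^n, and the remaining case puts c
  strictly between two neighbours among them.\<close>

lemma admissible_regular:
  assumes q: "0 < q" "q < 1" and adm: "admissible q a c d"
  shows "c \<noteq> of_real (a * q powi n)"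
proof
  assume c: "c = of_real (a * q powi n)"
  have a: "a > 0" using adm by (simp add: admissible_def)
  have mono: "a * q powi j \<le> a * q powi i" if "i \<le> j" for i j :: int
  proof -
    have "q powi j = q powi i * q ^ nat (j - i)"
      using that q by (simp flip: power_int_add power_int_of_nat)
    also have "\<dots> \<le> q powi i * 1" using q by (intro mult_left_mono power_le_one) auto
    finally show ?thesis using a by simp
  qed
  have real: "c \<in> \<real>" unfolding c by (rule Reals_of_real)
  show False
    using adm unfolding admissible_def
  proof (elim conjE disjE exE)
    fix c' d' m assume "c = of_real c'" "a * q powi m < c'" "c' < a * q powi (m - 1)"
    hence "a * q powi m < a * q powi n" "a * q powi n < a * q powi (m - 1)"
      using c by (simp_all del: of_real_mult)
    thus False using mono[of n "m - 1"] mono[of m n] by (cases "n \<le> m - 1") auto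
  next
    fix c' d' assume "c = of_real c'" "c' < 0"
    hence "a * q powi n < 0" using c by (simp del: of_real_mult)
    moreover have "a * q powi n > 0" using a q by simp
    ultimately show False by simp
  qed (use real in auto)
qed

theorem theorem5p3:
  fixes q a :: real and c d :: complex and lam :: "nat \<Rightarrow> nat"
  assumes "0 < q" and "q < 1"
    and "admissible q a c d"
    and "is_partition lam"
  shows "sym_converges (plength lam)
    (\<lambda>N. qMeixner_multi lam N (of_real q) (of_real a)
           (c * of_real q powi (1 - int N)) (d * of_real q powi (1 - int N)))
    (qMeixner_sym lam (of_real q) (of_real a) c d)"
proof -
  define Q where "Q = complex_of_real q"
  define A where "A = complex_of_real a"
  note lam = \<open>is_partition lam\<close>
  have nz: "Q \<noteq> 0" "norm Q < 1" "A \<noteq> 0" "c \<noteq> 0" "d \<noteq> 0"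
    using assms admissible_nonzero[OF assms(1-3)] by (auto simp: Q_def A_def)
  define s where "s N = Q powi (1 - int N)" for N
  have s: "s N \<noteq> 0" for N using nz by (simp add: s_def)
  define B where "B N = meixner_coeff Q A (c * s N) (d * s N)" for N
  define nodes where "nodes N i = Q powi (int N - 1 - int i)" for N i
  define P where "P mu = {nu. is_partition nu \<and> nu \<le> mu}" for mu :: "nat \<Rightarrow> nat"
  let ?l = "plength lam"
  let ?g = "\<lambda>N n. (A / (c * s N * (d * s N) * Q ^ n)) ^ n"
  \<comment> \<open>The normalization contributes c^(|mu|-|lam|), whereas \<open>sigma_qM\<close>
    contains only c^(-|lam|); the extra c^|mu| cancels later against the rescaling of the
    nodes.\<close>
  define b where "b mu = c ^ psize mu * sigma_qM lam mu Q A c d" for mu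
  define a' where "a' N mu = fdet ?l (\<lambda>i k. B N (beta N lam i) (beta N mu k))" for N mu

  have lim_a: "(\<lambda>N. a' N mu) \<longlonglongrightarrow> b mu" if "mu \<in> P lam" for mu
  proof -
    from that have mu: "is_partition mu" "mu \<le> lam" by (auto simp: P_def)
    have len: "plength mu \<le> ?l" by (rule plength_mono[OF mu(1) lam mu(2)])
    let ?h = "\<lambda>N n. meixner_norm Q A (c * s N) (d * s N) n"
    let ?\<rho> = "\<lambda>N. \<Prod>i<?l. qpoch Q Q (beta N lam i) / qpoch Q Q (beta N mu i)"
    have eq: "?\<rho> N * b mu = a' N mu" if "N \<ge> ?l" for N
    proof -
      have "a' N mu = fdet ?l (\<lambda>i k. ?h N (beta N lam i) * sigma_entry lam mu Q A c i k *
          inverse (?h N (beta N mu k)))"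
        unfolding a'_def B_def s_def
        by (rule fdet_cong) (use that nz in \<open>auto intro!: meixner_coeff_beta\<close>)
      also have "\<dots> = (\<Prod>i<?l. ?h N (beta N lam i)) * (\<Prod>i<?l. inverse (?h N (beta N mu i))) *
          fdet ?l (sigma_entry lam mu Q A c)"
        by (rule fdet_scale_rows_columns)
      also have "(\<Prod>i<?l. ?h N (beta N lam i)) * (\<Prod>i<?l. inverse (?h N (beta N mu i))) =
          (\<Prod>i<?l. (qpoch Q Q (beta N lam i) / qpoch Q Q (beta N mu i)) *
            (?g N (beta N lam i) / ?g N (beta N mu i)))"
        unfolding prod.distrib[symmetric]
        by (intro prod.cong refl) (simp only: meixner_norm_def divide_inverse inverse_mult_distrib mult_ac)
      also have "\<dots> = ?\<rho> N * (\<Prod>i<?l. ?g N (beta N lam i) / ?g N (beta N mu i))"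
        by (rule prod.distrib)
      also have "(\<Prod>i<?l. ?g N (beta N lam i) / ?g N (beta N mu i)) =
          c powi (int (psize mu) - int (psize lam)) *
          (A / (Q * d)) powi (int (psize lam) - int (psize mu)) *
          Q powi (2 * (int (pweight (ptranspose mu)) - int (pweight mu)
                    - int (pweight (ptranspose lam)) + int (pweight lam)))"
        unfolding s_def by (rule prod_meixner_power[OF nz(1,3,4,5) lam order.refl mu(1) len that])
      also have "c powi (int (psize mu) - int (psize lam)) = c ^ psize mu * c powi (- int (psize lam))"
        using nz(4) by (simp add: power_int_diff power_int_minus divide_inverse)
      finally show ?thesis by (simp add: b_def sigma_qM_def mult_ac)
    qed
    have "(\<lambda>N. ?\<rho> N * b mu) \<longlonglongrightarrow> (\<Prod>i<?l. 1) * b mu"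
      by (intro tendsto_mult tendsto_prod tendsto_const tendsto_qpoch_ratio nz le_funD[OF mu(2)])
    hence "(\<lambda>N. ?\<rho> N * b mu) \<longlonglongrightarrow> b mu" by simp
    moreover have "eventually (\<lambda>N. ?\<rho> N * b mu = a' N mu) sequentially"
      using eventually_ge_at_top[of ?l] by eventually_elim (rule eq)
    ultimately show ?thesis by (rule Lim_transform_eventually)
  qed

  have expand: "qMeixner_multi lam N Q A (c * s N) (d * s N) =
      (\<Sum>mu\<in>P lam. \<Sum>nu\<in>P mu. Const (a' N mu *
        (c ^ psize nu / c ^ psize mu * genpow_det (nodes N) N mu nu)) * schur_poly nu N)"
    if N: "N \<ge> ?l" for N
  proof -
    interpret Const: comm_ring_hom Const by (rule comm_ring_hom_Const)
    have regular: "qpoch (c * s N * Q / A) Q k \<noteq> 0" for k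
    proof -
      \<comment> \<open>A vanishing denominator would make c equal to a times an integer power of
        q.\<close>
      have "c * s N * Q / A * Q ^ j \<noteq> 1" for j
      proof
        assume "c * s N * Q / A * Q ^ j = 1"
        hence "c * (s N * Q ^ Suc j) = A" using nz by (simp add: field_simps)
        also have "s N * Q ^ Suc j = Q powi (1 - int N + int (Suc j))"
          unfolding s_def using nz by (simp only: power_int_add power_int_of_nat simp_thms)
        finally obtain e where "c * Q powi e = A" by blast
        hence "c = A * Q powi (- e)"
          using nz by (simp add: power_int_minus field_simps)
        hence "c = of_real (a * q powi (- e))"
          by (simp only: A_def Q_def of_real_mult of_real_power_int)
        thus False using admissible_regular[OF assms(1-3)] by blast
      qed
      thus ?thesis using nz by (simp add: qpoch_def)
    qed
    \<comment> \<open>The zeros of (c q^(1-N) x; q)_k are the interpolation nodes divided by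
      c.\<close>
    have node: "inverse (c * s N * Q ^ i) = inverse c * nodes N i" for i
    proof -
      have "s N * Q ^ i = Q powi (1 - int N + int i)"
        unfolding s_def using nz by (simp only: power_int_add power_int_of_nat simp_thms)
      hence "inverse (s N * Q ^ i) = Q powi (- (1 - int N + int i))"
        by (simp only: power_int_minus)
      also have "- (1 - int N + int i) = int N - 1 - int i" by simp
      finally show ?thesis by (simp add: nodes_def mult.assoc)
    qed
    have nzs: "c * s N \<noteq> 0" "d * s N \<noteq> 0" using nz s by simp_all
    have qM: "qMeixner Q A (c * s N) (d * s N) n =
        (\<Sum>k\<le>n. smult (B N n k) (genpow (\<lambda>i. inverse c * nodes N i) k))" for n
      using qMeixner_expansion[OF nz(1-3) nzs regular, of n] unfolding B_def node .
    let ?R = "\<lambda>mu. \<Sum>nu | is_partition nu \<and> nu \<le> mu.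
        Const (genpow_det (\<lambda>i. inverse c * nodes N i) N mu nu) * schur_poly nu N"
    have "qMeixner_multi lam N Q A (c * s N) (d * s N) = (\<Sum>mu\<in>P lam. Const (a' N mu) * ?R mu)"
      unfolding qMeixner_multi_def a'_def P_def
    proof (rule multivariateI, rule multivariate_expansion[OF qM _ _ lam N])
      show "B N n n = 1" for n
        unfolding B_def by (rule meixner_coeff_self[OF nz(1-3) nzs])
      show "B N n k = 0" if "n < k" for n k
        using that by (simp add: B_def meixner_coeff_def)
      show "?R mu * vandermonde N = alternant (genpow (\<lambda>i. inverse c * nodes N i)) mu N"
        if "is_partition mu" "mu \<le> lam" for mu
        using plength_mono[OF that(1) lam that(2)] N by (intro genpow_alternant that) simp
    qed
    also have "\<dots> = (\<Sum>mu\<in>P lam. \<Sum>nu\<in>P mu. Const (a' N mu *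
        (c ^ psize nu / c ^ psize mu * genpow_det (nodes N) N mu nu)) * schur_poly nu N)"
      unfolding sum_distrib_left P_def[symmetric]
    proof (intro sum.cong refl)
      fix mu nu assume "mu \<in> P lam" "nu \<in> P mu"
      hence mu: "is_partition mu" "mu \<le> lam" and nu: "is_partition nu" "nu \<le> mu" by (auto simp: P_def)
      have "plength mu \<le> N" using plength_mono[OF mu(1) lam mu(2)] N by simp
      hence "genpow_det (\<lambda>i. inverse c * nodes N i) N mu nu =
          inverse c ^ psize mu / inverse c ^ psize nu * genpow_det (nodes N) N mu nu"
        using nz by (intro genpow_det_scale mu nu) auto
      also have "inverse c ^ psize mu / inverse c ^ psize nu = c ^ psize nu / c ^ psize mu"
        by (simp add: power_inverse divide_inverse mult.commute)
      finally show "Const (a' N mu) * (Const (genpow_det (\<lambda>i. inverse c * nodes N i) N mu nu) * schur_poly nu N) =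
          Const (a' N mu * (c ^ psize nu / c ^ psize mu * genpow_det (nodes N) N mu nu)) * schur_poly nu N"
        by (simp only: Const.hom_mult mult.assoc)
    qed
    finally show ?thesis .
  qed

  have fin: "finite (P mu)" if "is_partition mu" for mu
    unfolding P_def by (rule finite_subpartitions[OF that])
  \<comment> \<open>Pairs (mu, nu) are kept apart, so terms with the same Schur polynomial need not
    be collected.\<close>
  let ?T = "Sigma (P lam) P"
  have "sym_converges ?l (\<lambda>N. qMeixner_multi lam N Q A (c * s N) (d * s N))
      (\<lambda>m. \<Sum>t\<in>?T. (b (fst t) * (c ^ psize (snd t) / c ^ psize (fst t) * interp_coeff Q (fst t) (snd t)))
        * schur_fun (snd t) m)"
  proof (rule sym_converges_schur_expansion)
    show "finite ?T" using fin lam by (intro finite_SigmaI) (auto simp: P_def)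
    fix t assume "t \<in> ?T"
    then obtain mu nu where t: "t = (mu, nu)" "mu \<in> P lam" "nu \<in> P mu" by auto
    hence mu: "is_partition mu" "mu \<le> lam" and nu: "is_partition nu" "nu \<le> mu" by (auto simp: P_def)
    show "is_partition (snd t)" using nu t by simp
    show "plength (snd t) \<le> ?l"
      using plength_mono[OF nu(1) mu(1) nu(2)] plength_mono[OF mu(1) lam mu(2)] t by simp
    show "(\<lambda>N. a' N (fst t) * (c ^ psize (snd t) / c ^ psize (fst t) * genpow_det (nodes N) N (fst t) (snd t)))
        \<longlonglongrightarrow> b (fst t) * (c ^ psize (snd t) / c ^ psize (fst t) * interp_coeff Q (fst t) (snd t))"
      unfolding nodes_def using t by (intro tendsto_mult tendsto_const lim_a tendsto_interp_coeff nz) simp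
  next
    fix N assume "?l \<le> N"
    from expand[OF this]
    show "qMeixner_multi lam N Q A (c * s N) (d * s N) = (\<Sum>t\<in>?T. Const (a' N (fst t) *
        (c ^ psize (snd t) / c ^ psize (fst t) * genpow_det (nodes N) N (fst t) (snd t))) * schur_poly (snd t) N)"
      using fin lam by (subst (asm) sum.Sigma) (auto simp: P_def split_def)
  qed
  also have "(\<lambda>m. \<Sum>t\<in>?T. (b (fst t) * (c ^ psize (snd t) / c ^ psize (fst t) * interp_coeff Q (fst t) (snd t)))
        * schur_fun (snd t) m) = qMeixner_sym lam Q A c d"
  proof
    fix m
    have "(\<Sum>t\<in>?T. (b (fst t) * (c ^ psize (snd t) / c ^ psize (fst t) * interp_coeff Q (fst t) (snd t)))
        * schur_fun (snd t) m) =
        (\<Sum>mu\<in>P lam. \<Sum>nu\<in>P mu. (b mu * (c ^ psize nu / c ^ psize mu * interp_coeff Q mu nu)) * schur_fun nu m)"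
      using fin lam by (subst sum.Sigma) (auto simp: P_def split_def)
    also have "\<dots> = (\<Sum>mu\<in>P lam. sigma_qM lam mu Q A c d * rescale c (interp_sym mu Q) m)"
    proof (rule sum.cong[OF refl])
      fix mu assume "mu \<in> P lam"
      hence mu: "is_partition mu" by (simp add: P_def)
      \<comment> \<open>Where the Schur coefficient is nonzero, m has degree |nu|, so c^|nu| is
        exactly the factor \<open>c ^ mdeg m\<close> of \<open>rescale\<close>.\<close>
      have "(b mu * (c ^ psize nu / c ^ psize mu * interp_coeff Q mu nu)) * schur_fun nu m =
          sigma_qM lam mu Q A c d * (c ^ mdeg m * (interp_coeff Q mu nu * schur_fun nu m))"
        if "nu \<in> P mu" for nu
      proof (cases "schur_fun nu m = 0")
        case False
        hence "mdeg m = psize nu" using that by (intro schur_fun_homogeneous) (auto simp: P_def)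
        thus ?thesis using nz by (simp add: b_def)
      qed simp
      thus "(\<Sum>nu\<in>P mu. (b mu * (c ^ psize nu / c ^ psize mu * interp_coeff Q mu nu)) * schur_fun nu m) =
          sigma_qM lam mu Q A c d * rescale c (interp_sym mu Q) m"
        by (simp add: rescale_def interp_sym_eq[OF nz(1,2) mu] sum_distrib_left P_def)
    qed
    finally show "(\<Sum>t\<in>?T. (b (fst t) * (c ^ psize (snd t) / c ^ psize (fst t) * interp_coeff Q (fst t) (snd t)))
        * schur_fun (snd t) m) = qMeixner_sym lam Q A c d m"
      by (simp add: qMeixner_sym_def P_def)
  qed
  finally show ?thesis by (simp only: s_def Q_def A_def)
qed

end
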